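(* Let $\gamma\equiv\gamma^{(2n)}=\{\gamma_{ij}\}_{i,j\in\mathbb{Z}_+^d,\;|i|+|j|\le 2n}$ be a complex sequence whose moment matrix $M(n)\equiv M^d(n)(\gamma)$ is positive semidefinite and admits a rank-preserving (positive semidefinite) moment matrix extension $M(n+1)$. Let $r:=\operatorname{rank}M(n)$ and $\mathcal{V}:=\mathcal{V}(M(n+1))$. Then $\operatorname{card}\mathcal{V}=r$, and $\mathcal{V}\equiv\{\omega_j\}_{j=1}^r$ forms the support of the unique representing measure $\nu$ for $M(n+1)$. If $\mathcal{B}\equiv\{\bar Z^{i_k}Z^{j_k}\}_{k=1}^r$ is a maximal linearly independent subset of columns of $M(n)$, then the $r\times r$ matrix $W_{\mathcal{B},\mathcal{V}}$ (whose entry in row $m$, column $k$ is $\bar\omega_k^{i_m}\omega_k^{j_m}$) is invertible, and $\nu=\sum_{j=1}^r\rho_j\delta_{\omega_j}$, where $\rho\equiv(\rho_1,\dots,\rho_r)$ is uniquely determined by $\rho^t=W_{\mathcal{B},\mathcal{V}}^{-1}(\gamma_{i_1,j_1},\dots,\gamma_{i_r,j_r})^t$.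
   Context: $\mathbb{C}_l^d[z,\bar z]$ is the space of complex polynomials of total degree $\le l$ in $z=(z_1,\dots,z_d)$, $\bar z=(\bar z_1,\dots,\bar z_d)$, with basis the monomials $\bar z^iz^j$, $|i|+|j|\le l$ ($i,j\in\mathbb{Z}_+^d$, $|i|=i_1+\dots+i_d$); $\hat f$ is the coefficient vector of $f$ in this basis. Riesz functional: $\Lambda_\gamma(\sum b_{rs}\bar z^rz^s)=\sum b_{rs}\gamma_{rs}$ on $\mathbb{C}^d_{2n}[z,\bar z]$. The moment matrix $M^d(n)(\gamma)$ is the square matrix with rows and columns indexed by the monomials of degree $\le n$ determined by $\langle M^d(n)(\gamma)\hat f,\hat g\rangle=\Lambda_\gamma(f\bar g)$, $f,g\in\mathbb{C}_n^d[z,\bar z]$. The column indexed by $\bar z^iz^j$ is denoted $\bar Z^iZ^j$, and for $p=\sum a_{rs}\bar z^rz^s\in\mathbb{C}_n^d[z,\bar z]$, $p(Z,\bar Z):=\sum a_{rs}\bar Z^rZ^s$. The variety of $M(n)$ is $\mathcal{V}(M(n)):=\bigcap\{\mathcal{Z}(p):p\in\mathbb{C}_n^d[z,\bar z],\ p(Z,\bar Z)=0\}$, with $\mathcal{Z}(p)=\{z\in\mathbb{C}^d:p(z,\bar z)=0\}$; $\mathcal{V}(M(n+1))$ is defined in the same way with $n+1$ in place of $n$. A moment matrix extension $M(n+1)$ of $M(n)(\gamma)$ is $M^d(n+1)(\tilde\gamma)$ with $\tilde\gamma=\tilde\gamma^{(2n+2)}$ extending $\gamma$; rank-preserving means $\operatorname{rank}M(n+1)=\operatorname{rank}M(n)$.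 A representing measure for $M^d(n+1)(\tilde\gamma)$ is a positive Borel measure $\nu$ on $\mathbb{C}^d$ with $\tilde\gamma_{ij}=\int\bar z^iz^j\,d\nu$ (convergent) for $|i|+|j|\le 2n+2$. *)

theory Defs
  imports
    "HOL-Analysis.Analysis"
    "HOL-Probability.Giry_Monad"
    "HOL-Library.Poly_Mapping"
    "Jordan_Normal_Form.DL_Rank"
    "Jordan_Normal_Form.Gauss_Jordan_Elimination"
begin

text \<open>Points of \<open>\<complex>\<^sup>d\<close> and multi-indices are finite Cartesian products (\<open>$\<close> selects a
  component), whereas moment matrices, whose size depends on the degree, are matrices of
  \<open>Jordan_Normal_Form\<close>, entered with \<open>vec_index\<close> and \<open>$$\<close>.\<close>

no_notation Matrix.vec_index (infixl \<open>$\<close> 100)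

text \<open>The pair \<open>(i, j)\<close> stands for the monomial with exponent \<open>i\<close> on the conjugate variables and
  exponent \<open>j\<close> on the variables.  Multiplying monomials adds exponents, so the ring structure of
  \<open>\<Rightarrow>\<^sub>0\<close> is that of the polynomial ring.\<close>

type_synonym 'd mono = "(nat ^ 'd) \<times> (nat ^ 'd)"
type_synonym 'd zpoly = "'d mono \<Rightarrow>\<^sub>0 complex"

definition mono_degree :: "'d::finite mono \<Rightarrow> nat" where
  "mono_degree m = (\<Sum>k\<in>UNIV. fst m $ k) + (\<Sum>k\<in>UNIV. snd m $ k)"

definition mono_eval :: "'d::finite mono \<Rightarrow> complex ^ 'd \<Rightarrow> complex" where
  "mono_eval m z = (\<Prod>k\<in>UNIV. cnj (z $ k) ^ (fst m $ k)) * (\<Prod>k\<in>UNIV. (z $ k) ^ (snd m $ k))"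

definition poly_eval :: "'d::finite zpoly \<Rightarrow> complex ^ 'd \<Rightarrow> complex" where
  "poly_eval p z = (\<Sum>m\<in>Poly_Mapping.keys p. Poly_Mapping.lookup p m * mono_eval m z)"

definition poly_space :: "nat \<Rightarrow> 'd::finite zpoly set" where
  "poly_space l = {p. \<forall>m\<in>Poly_Mapping.keys p. mono_degree m \<le> l}"

definition zero_set :: "'d::finite zpoly \<Rightarrow> (complex ^ 'd) set" where
  "zero_set p = {z. poly_eval p z = 0}"

definition zmonom :: "'d::finite mono \<Rightarrow> 'd zpoly" where
  "zmonom m = Poly_Mapping.single m 1"

text \<open>Complex conjugation conjugates the coefficients and exchanges the two exponents.\<close>

definition conj_poly :: "'d::finite zpoly \<Rightarrow> 'd zpoly" where
  "conj_poly p = Poly_Mapping.map_key prod.swap (Poly_Mapping.map cnj p)"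

text \<open>A sequence \<open>\<gamma>\<close> truncated at degree \<open>l\<close> is a function of two multi-indices of which only the
  values \<open>\<gamma> i j\<close> with \<open>|i| + |j| \<le> l\<close> are ever used.\<close>

definition riesz :: "(nat ^ 'd::finite \<Rightarrow> nat ^ 'd \<Rightarrow> complex) \<Rightarrow> 'd zpoly \<Rightarrow> complex" where
  "riesz \<gamma> p = (\<Sum>m\<in>Poly_Mapping.keys p. Poly_Mapping.lookup p m * \<gamma> (fst m) (snd m))"

text \<open>Rows and columns are numbered by an arbitrary but fixed enumeration of the monomials.\<close>

definition mono_list :: "nat \<Rightarrow> 'd::finite mono list" where
  "mono_list l = (SOME ms. distinct ms \<and> set ms = {m. mono_degree m \<le> l})"

definition num_monos :: "'d::finite itself \<Rightarrow> nat \<Rightarrow> nat" where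
  "num_monos _ l = card {m :: 'd mono. mono_degree m \<le> l}"

definition coeff_vec :: "nat \<Rightarrow> 'd::finite zpoly \<Rightarrow> complex Matrix.vec" where
  "coeff_vec l p = Matrix.vec (num_monos TYPE('d) l)
     (\<lambda>k. Poly_Mapping.lookup p (mono_list l ! k))"

text \<open>The entries are those forced by the identity \<open>\<langle>M f, g\<rangle> = \<Lambda> (f * conj g)\<close> on monomials;
  \<open>moment_matrix_inner\<close> and \<open>moment_matrix_unique\<close> below show that the identity holds for all
  polynomials of degree at most \<open>n\<close> and determines the matrix.\<close>

definition moment_matrix ::
  "nat \<Rightarrow> (nat ^ 'd::finite \<Rightarrow> nat ^ 'd \<Rightarrow> complex) \<Rightarrow> complex Matrix.mat" where
  "moment_matrix n \<gamma> = Matrix.mat (num_monos TYPE('d) n) (num_monos TYPE('d) n)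
     (\<lambda>(a, b). riesz \<gamma> (zmonom (mono_list n ! b) * conj_poly (zmonom (mono_list n ! a))))"

definition moment_col ::
  "nat \<Rightarrow> (nat ^ 'd::finite \<Rightarrow> nat ^ 'd \<Rightarrow> complex) \<Rightarrow> 'd mono \<Rightarrow> complex Matrix.vec" where
  "moment_col n \<gamma> m =
     Matrix.col (moment_matrix n \<gamma>) (THE b. b < num_monos TYPE('d) n \<and> mono_list n ! b = m)"

definition poly_col ::
  "nat \<Rightarrow> (nat ^ 'd::finite \<Rightarrow> nat ^ 'd \<Rightarrow> complex) \<Rightarrow> 'd zpoly \<Rightarrow> complex Matrix.vec" where
  "poly_col n \<gamma> p = finsum_vec TYPE(complex) (num_monos TYPE('d) n)
     (\<lambda>m. Poly_Mapping.lookup p m \<cdot>\<^sub>v moment_col n \<gamma> m) (Poly_Mapping.keys p)"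

definition moment_variety ::
  "nat \<Rightarrow> (nat ^ 'd::finite \<Rightarrow> nat ^ 'd \<Rightarrow> complex) \<Rightarrow> (complex ^ 'd) set" where
  "moment_variety n \<gamma> =
     (\<Inter>p \<in> {p \<in> poly_space n. poly_col n \<gamma> p = 0\<^sub>v (num_monos TYPE('d) n)}. zero_set p)"

definition moment_rank :: "nat \<Rightarrow> (nat ^ 'd::finite \<Rightarrow> nat ^ 'd \<Rightarrow> complex) \<Rightarrow> nat" where
  "moment_rank n \<gamma> = vec_space.rank (num_monos TYPE('d) n) (moment_matrix n \<gamma>)"

definition psd_mat :: "complex Matrix.mat \<Rightarrow> bool" where
  "psd_mat A \<longleftrightarrow> square_mat A \<and>
     (\<forall>v\<in>carrier_vec (dim_row A). (A *\<^sub>v v) \<bullet>c v \<in> \<real> \<and> 0 \<le> Re ((A *\<^sub>v v) \<bullet>c v))"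

text \<open>A family of columns of \<open>M(n)\<close> is given by the list of the monomials labelling them; no column
  (as a vector) may occur twice.\<close>

definition max_indpt_columns ::
  "nat \<Rightarrow> (nat ^ 'd::finite \<Rightarrow> nat ^ 'd \<Rightarrow> complex) \<Rightarrow> 'd mono list \<Rightarrow> bool" where
  "max_indpt_columns n \<gamma> bs \<longleftrightarrow>
     (\<forall>m\<in>set bs. mono_degree m \<le> n) \<and> distinct (map (moment_col n \<gamma>) bs) \<and>
     maximal (set (map (moment_col n \<gamma>) bs))
       (\<lambda>T. T \<subseteq> set (cols (moment_matrix n \<gamma>)) \<and>
            module.lin_indpt class_ring (module_vec TYPE(complex) (num_monos TYPE('d) n)) T)"

definition W_mat :: "'d::finite mono list \<Rightarrow> (complex ^ 'd) list \<Rightarrow> complex Matrix.mat" where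
  "W_mat bs ws = Matrix.mat (length bs) (length ws) (\<lambda>(m, k). mono_eval (bs ! m) (ws ! k))"

definition representing_measure ::
  "nat \<Rightarrow> (nat ^ 'd::finite \<Rightarrow> nat ^ 'd \<Rightarrow> complex) \<Rightarrow> (complex ^ 'd) measure \<Rightarrow> bool" where
  "representing_measure l \<gamma> \<nu> \<longleftrightarrow> sets \<nu> = sets borel \<and>
     (\<forall>i j. mono_degree (i, j) \<le> l \<longrightarrow>
        integrable \<nu> (mono_eval (i, j)) \<and> \<gamma> i j = (LINT z|\<nu>. mono_eval (i, j) z))"

definition measure_support :: "'a::topological_space measure \<Rightarrow> 'a set" where
  "measure_support \<nu> = {x. \<forall>U. open U \<and> x \<in> U \<longrightarrow> emeasure \<nu> U > 0}"

text \<open>The measure \<open>\<Sum>\<^sub>k \<rho>\<^sub>k \<delta>\<^bsub>\<omega>\<^sub>k\<^esub>\<close>; \<open>return borel \<omega>\<close> is the point mass at \<open>\<omega>\<close>.\<close>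

definition atomic_measure :: "'a::topological_space list \<Rightarrow> (nat \<Rightarrow> real) \<Rightarrow> 'a measure" where
  "atomic_measure ws \<rho> = measure_of UNIV (sets borel)
     (\<lambda>A. \<Sum>k<length ws. ennreal (\<rho> k) * emeasure (return borel (ws ! k)) A)"

lemma emeasure_atomic_measure:
  assumes "A \<in> sets (borel :: 'a::topological_space measure)"
  shows "emeasure (atomic_measure ws \<rho>) A = (\<Sum>k<length ws. ennreal (\<rho> k) * indicator A (ws ! k))"
proof -
  let ?\<mu> = "\<lambda>A. \<Sum>k<length ws. ennreal (\<rho> k) * emeasure (return borel (ws ! k)) A"
  have "emeasure (atomic_measure ws \<rho>) A = ?\<mu> A"
  proof (rule emeasure_measure_of[OF atomic_measure_def])
    show "sets borel \<subseteq> Pow (UNIV :: 'a set)" by simp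
    show "A \<in> sets (atomic_measure ws \<rho>)"
      using assms sets.sigma_sets_eq[of "borel :: 'a measure"] by (simp add: atomic_measure_def)
    show "positive (sets (atomic_measure ws \<rho>)) ?\<mu>" by (simp add: positive_def)
    show "countably_additive (sets (atomic_measure ws \<rho>)) ?\<mu>"
    proof (rule countably_additiveI)
      fix B :: "nat \<Rightarrow> 'a set"
      assume B: "range B \<subseteq> sets (atomic_measure ws \<rho>)" and d: "disjoint_family B"
      have "range B \<subseteq> sets borel"
        using B sets.sigma_sets_eq[of "borel :: 'a measure"] by (simp add: atomic_measure_def)
      then have "suminf (\<lambda>i. emeasure (return borel x) (B i)) = emeasure (return borel x) (\<Union>i. B i)" for x :: 'a
        using d by (intro suminf_emeasure) auto
      then show "suminf (\<lambda>i. ?\<mu> (B i)) = ?\<mu> (\<Union>i. B i)"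
        by (simp only: suminf_sum[OF summableI] ennreal_suminf_cmult)
    qed
  qed
  then show ?thesis using assms by simp
qed


lemma finite_monos: "finite {m :: 'd::finite mono. mono_degree m \<le> l}"
proof -
  have fin: "finite {i :: nat ^ 'd. \<forall>k. i $ k \<in> {..l}}"
  proof (rule finite_imageD[where f = vec_nth])
    have "finite (PiE (UNIV :: 'd set) (\<lambda>_. {..l}))" by (intro finite_PiE) auto
    then show "finite (vec_nth ` {i :: nat ^ 'd. \<forall>k. i $ k \<in> {..l}})"
      by (rule finite_subset[rotated]) auto
    show "inj_on vec_nth {i :: nat ^ 'd. \<forall>k. i $ k \<in> {..l}}"
      by (simp add: inj_on_def vec_nth_inject)
  qed
  have le: "i $ k \<le> (\<Sum>k\<in>UNIV. i $ k)" for i :: "nat ^ 'd" and k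
    by (rule member_le_sum) auto
  have "fst m $ k \<le> l \<and> snd m $ k \<le> l" if "mono_degree m \<le> l" for m :: "'d mono" and k
    using that le[of "fst m" k] le[of "snd m" k] by (auto simp: mono_degree_def)
  then show ?thesis
    by (intro finite_subset[OF _ finite_cartesian_product[OF fin fin]]) (auto simp: mem_Times_iff)
qed

lemma mono_list_props:
  "distinct (mono_list l :: 'd::finite mono list)"
  "set (mono_list l :: 'd mono list) = {m. mono_degree m \<le> l}"
  "length (mono_list l :: 'd mono list) = num_monos TYPE('d) l"
proof -
  have "\<exists>ms :: 'd mono list. distinct ms \<and> set ms = {m. mono_degree m \<le> l}"
    using finite_distinct_list[OF finite_monos] by blast
  from someI_ex[OF this, folded mono_list_def]
  show *: "distinct (mono_list l :: 'd mono list)"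
    "set (mono_list l :: 'd mono list) = {m. mono_degree m \<le> l}" by auto
  show "length (mono_list l :: 'd mono list) = num_monos TYPE('d) l"
    using distinct_card[OF *(1)] by (simp add: *(2) num_monos_def)
qed

lemma moment_col_nth:
  fixes \<gamma> :: "nat ^ 'd::finite \<Rightarrow> nat ^ 'd \<Rightarrow> complex"
  assumes "b < num_monos TYPE('d) n"
  shows "moment_col n \<gamma> (mono_list n ! b) = Matrix.col (moment_matrix n \<gamma>) b"
proof -
  have "(THE c. c < num_monos TYPE('d) n \<and> (mono_list n :: 'd mono list) ! c = mono_list n ! b) = b"
    using assms mono_list_props[where 'd = 'd and l = n]
    by (intro the_equality) (auto simp: nth_eq_iff_index_eq)
  then show ?thesis by (simp add: moment_col_def)
qed

lemma lookup_conj_poly: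
  "Poly_Mapping.lookup (conj_poly p) m = cnj (Poly_Mapping.lookup p (prod.swap m))"
  by (simp add: conj_poly_def map_key.rep_eq map.rep_eq when_def)

lemma riesz_superset:
  assumes "finite S" "Poly_Mapping.keys p \<subseteq> S"
  shows "riesz \<gamma> p = (\<Sum>m\<in>S. Poly_Mapping.lookup p m * \<gamma> (fst m) (snd m))"
  unfolding riesz_def using assms by (intro sum.mono_neutral_left) (auto simp: in_keys_iff)

lemma riesz_add: "riesz \<gamma> (p + q) = riesz \<gamma> p + riesz \<gamma> q"
proof -
  let ?S = "Poly_Mapping.keys p \<union> Poly_Mapping.keys q"
  have "riesz \<gamma> (p + q) = (\<Sum>m\<in>?S. Poly_Mapping.lookup (p + q) m * \<gamma> (fst m) (snd m))"
    by (rule riesz_superset[OF _ Poly_Mapping.keys_add]) auto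
  also have "\<dots> = riesz \<gamma> p + riesz \<gamma> q"
    by (simp add: riesz_superset[of ?S p] riesz_superset[of ?S q] lookup_add
        distrib_right sum.distrib)
  finally show ?thesis .
qed

lemma riesz_sum: "riesz \<gamma> (sum f A) = (\<Sum>x\<in>A. riesz \<gamma> (f x))"
proof (induction A rule: infinite_finite_induct)
  case (insert x F)
  then show ?case by (simp add: riesz_add)
qed (simp_all add: riesz_def)

lemma riesz_single: "riesz \<gamma> (Poly_Mapping.single m c) = c * \<gamma> (fst m) (snd m)"
  by (simp add: riesz_def)

lemma zpoly_expand:
  assumes "finite S" "Poly_Mapping.keys p \<subseteq> S"
  shows "p = (\<Sum>m\<in>S. Poly_Mapping.single m (Poly_Mapping.lookup p m))"
proof -
  have "p = (\<Sum>m\<in>Poly_Mapping.keys p. Poly_Mapping.single m (Poly_Mapping.lookup p m))"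
    by (intro poly_mapping_eqI)
      (auto simp: lookup_sum lookup_single when_def sum.delta in_keys_iff)
  also have "\<dots> = (\<Sum>m\<in>S. Poly_Mapping.single m (Poly_Mapping.lookup p m))"
    using assms by (intro sum.mono_neutral_left) (auto simp: in_keys_iff)
  finally show ?thesis .
qed

lemma conj_poly_single: "conj_poly (Poly_Mapping.single m c) = Poly_Mapping.single (prod.swap m) (cnj c)"
  by (rule poly_mapping_eqI) (cases m, auto simp: lookup_conj_poly lookup_single when_def)

lemma conj_poly_add: "conj_poly (p + q) = conj_poly p + conj_poly q"
  by (rule poly_mapping_eqI) (simp add: lookup_conj_poly lookup_add)

lemma conj_poly_sum: "conj_poly (sum f A) = (\<Sum>x\<in>A. conj_poly (f x))"
proof (induction A rule: infinite_finite_induct)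
  case (insert x F)
  then show ?case by (simp add: conj_poly_add)
qed (auto intro!: poly_mapping_eqI simp: lookup_conj_poly)

lemma riesz_monom_prod:
  "riesz \<gamma> (zmonom (i, j) * conj_poly (zmonom (k, l))) = \<gamma> (i + l) (j + k)"
  by (simp add: zmonom_def conj_poly_single mult_single riesz_single)

lemma moment_matrix_carrier:
  fixes \<gamma> :: "nat ^ 'd::finite \<Rightarrow> nat ^ 'd \<Rightarrow> complex"
  shows "moment_matrix n \<gamma> \<in> carrier_mat (num_monos TYPE('d) n) (num_monos TYPE('d) n)"
  by (simp add: moment_matrix_def)

lemma riesz_prod_conj:
  assumes "finite S" "Poly_Mapping.keys f \<subseteq> S" "Poly_Mapping.keys g \<subseteq> S"
  shows "riesz \<gamma> (f * conj_poly g) = (\<Sum>m\<in>S. \<Sum>m'\<in>S. Poly_Mapping.lookup f m *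
    cnj (Poly_Mapping.lookup g m') * riesz \<gamma> (zmonom m * conj_poly (zmonom m')))"
proof -
  have "f * conj_poly g = (\<Sum>m\<in>S. \<Sum>m'\<in>S. Poly_Mapping.single m (Poly_Mapping.lookup f m) *
      conj_poly (Poly_Mapping.single m' (Poly_Mapping.lookup g m')))"
    by (subst zpoly_expand[OF assms(1,2)], subst zpoly_expand[OF assms(1,3)])
      (simp add: conj_poly_sum sum_product)
  then show ?thesis
    by (simp add: riesz_sum zmonom_def conj_poly_single mult_single riesz_single)
qed

theorem moment_matrix_inner:
  fixes \<gamma> :: "nat ^ 'd::finite \<Rightarrow> nat ^ 'd \<Rightarrow> complex"
  assumes f: "f \<in> poly_space n" and g: "g \<in> poly_space n"
  shows "(moment_matrix n \<gamma> *\<^sub>v coeff_vec n f) \<bullet>c coeff_vec n g = riesz \<gamma> (f * conj_poly g)"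
proof -
  let ?N = "num_monos TYPE('d) n"
  let ?ms = "mono_list n :: 'd mono list"
  let ?S = "{m :: 'd mono. mono_degree m \<le> n}"
  have bij: "bij_betw ((!) ?ms) {0..<?N} ?S"
    by (rule bij_betw_nth) (auto simp: mono_list_props)
  have "riesz \<gamma> (f * conj_poly g) = (\<Sum>m\<in>?S. \<Sum>m'\<in>?S. Poly_Mapping.lookup f m *
      cnj (Poly_Mapping.lookup g m') * riesz \<gamma> (zmonom m * conj_poly (zmonom m')))"
    using f g by (intro riesz_prod_conj finite_monos) (auto simp: poly_space_def)
  also have "\<dots> = (\<Sum>b = 0..<?N. \<Sum>a = 0..<?N. Poly_Mapping.lookup f (?ms ! b) *
      cnj (Poly_Mapping.lookup g (?ms ! a)) *
      riesz \<gamma> (zmonom (?ms ! b) * conj_poly (zmonom (?ms ! a))))"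
    by (simp add: sum.reindex_bij_betw[OF bij, symmetric])
  also have "\<dots> = (\<Sum>a = 0..<?N. \<Sum>b = 0..<?N. Poly_Mapping.lookup f (?ms ! b) *
      cnj (Poly_Mapping.lookup g (?ms ! a)) *
      riesz \<gamma> (zmonom (?ms ! b) * conj_poly (zmonom (?ms ! a))))"
    by (rule sum.swap)
  also have "\<dots> = (moment_matrix n \<gamma> *\<^sub>v coeff_vec n f) \<bullet>c coeff_vec n g"
    by (simp add: moment_matrix_def coeff_vec_def scalar_prod_def mult_mat_vec_def
        sum_distrib_right) (simp only: mult_ac)
  finally show ?thesis by simp
qed

theorem moment_matrix_unique:
  fixes \<gamma> :: "nat ^ 'd::finite \<Rightarrow> nat ^ 'd \<Rightarrow> complex" and n :: nat
  defines "N \<equiv> num_monos TYPE('d) n"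
  assumes A: "A \<in> carrier_mat N N"
    and inner: "\<And>f g :: 'd zpoly. f \<in> poly_space n \<Longrightarrow> g \<in> poly_space n \<Longrightarrow>
      (A *\<^sub>v coeff_vec n f) \<bullet>c coeff_vec n g = riesz \<gamma> (f * conj_poly g)"
  shows "A = moment_matrix n \<gamma>"
proof (rule eq_matI)
  fix a b assume "a < dim_row (moment_matrix n \<gamma>)" "b < dim_col (moment_matrix n \<gamma>)"
  then have ab: "a < N" "b < N" by (simp_all add: moment_matrix_def N_def)
  let ?ms = "mono_list n :: 'd mono list"
  have unit: "coeff_vec n (zmonom (?ms ! c)) = unit_vec N c" if "c < N" for c
    using that mono_list_props[where 'd = 'd and l = n]
    by (intro eq_vecI) (auto simp: coeff_vec_def zmonom_def lookup_single when_def N_def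
        nth_eq_iff_index_eq)
  have mem: "zmonom (?ms ! c) \<in> poly_space n" if "c < N" for c
    using that nth_mem[of c ?ms] mono_list_props[where 'd = 'd and l = n]
    by (auto simp: poly_space_def zmonom_def N_def)
  have cu: "conjugate (unit_vec N a :: complex Matrix.vec) = unit_vec N a"
    using ab by (intro eq_vecI) (auto simp: unit_vec_def)
  have "A $$ (a, b) = (A *\<^sub>v unit_vec N b) \<bullet>c unit_vec N a"
    using A ab by (auto simp: cu scalar_prod_right_unit)
  also have "\<dots> = riesz \<gamma> (zmonom (?ms ! b) * conj_poly (zmonom (?ms ! a)))"
    using inner[OF mem[OF ab(2)] mem[OF ab(1)]] by (simp add: unit ab)
  finally show "A $$ (a, b) = moment_matrix n \<gamma> $$ (a, b)"
    using ab by (simp add: moment_matrix_def N_def)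
qed (use A in \<open>auto simp: moment_matrix_def N_def\<close>)

theorem poly_col_eq_mult:
  fixes \<gamma> :: "nat ^ 'd::finite \<Rightarrow> nat ^ 'd \<Rightarrow> complex"
  assumes "p \<in> poly_space n"
  shows "poly_col n \<gamma> p = moment_matrix n \<gamma> *\<^sub>v coeff_vec n p"
proof -
  let ?N = "num_monos TYPE('d) n"
  let ?ms = "mono_list n :: 'd mono list"
  let ?S = "{m :: 'd mono. mono_degree m \<le> n}"
  have bij: "bij_betw ((!) ?ms) {0..<?N} ?S"
    by (rule bij_betw_nth) (auto simp: mono_list_props)
  have dim: "moment_col n \<gamma> m \<in> carrier_vec ?N" for m
    by (rule carrier_vecI) (simp add: moment_col_def moment_matrix_def)
  have carr: "poly_col n \<gamma> p \<in> carrier_vec ?N"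
    unfolding poly_col_def using dim by (intro finsum_vec_closed) auto
  show ?thesis
  proof (rule eq_vecI)
    fix a assume "a < dim_vec (moment_matrix n \<gamma> *\<^sub>v coeff_vec n p)"
    then have a: "a < ?N" by (simp add: moment_matrix_def)
    have "vec_index (poly_col n \<gamma> p) a =
        (\<Sum>m\<in>Poly_Mapping.keys p. vec_index (Poly_Mapping.lookup p m \<cdot>\<^sub>v moment_col n \<gamma> m) a)"
      unfolding poly_col_def using dim a by (intro index_finsum_vec) auto
    also have "\<dots> = (\<Sum>m\<in>Poly_Mapping.keys p. Poly_Mapping.lookup p m * vec_index (moment_col n \<gamma> m) a)"
      using a carrier_vecD[OF dim] by (intro sum.cong) auto
    also have "\<dots> = (\<Sum>m\<in>?S. Poly_Mapping.lookup p m * vec_index (moment_col n \<gamma> m) a)"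
      using assms by (intro sum.mono_neutral_left finite_monos) (auto simp: poly_space_def in_keys_iff)
    also have "\<dots> = (\<Sum>b = 0..<?N. Poly_Mapping.lookup p (?ms ! b) * vec_index (moment_col n \<gamma> (?ms ! b)) a)"
      by (simp add: sum.reindex_bij_betw[OF bij, symmetric])
    also have "\<dots> = vec_index (moment_matrix n \<gamma> *\<^sub>v coeff_vec n p) a"
      using a by (simp add: moment_col_nth scalar_prod_def coeff_vec_def moment_matrix_def mult.commute)
    finally show "vec_index (poly_col n \<gamma> p) a = vec_index (moment_matrix n \<gamma> *\<^sub>v coeff_vec n p) a" .
  qed (use carrier_vecD[OF carr] in \<open>simp add: moment_matrix_def\<close>)
qed

end

theory Submission
  imports Defs "Jordan_Normal_Form.Spectral_Radius"
begin

text \<open>Flatness says that every polynomial of degree at most \<open>n + 1\<close> agrees, up to the null space of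
  the form \<open>\<langle>f, g\<rangle> = \<Lambda> (f * conj g)\<close>, with one of degree at most \<open>n\<close>.  Hence multiplication by each
  variable and conjugate variable acts on the \<open>r\<close>-dimensional quotient; these operators commute and
  are mutually adjoint, so the quotient has an orthonormal basis of joint eigenvectors \<open>e\<^sub>k\<close>.  Their
  eigenvalues are the coordinates of points \<open>\<omega>\<^sub>k\<close>, and \<open>\<langle>f, e\<^sub>k\<rangle> = f(\<omega>\<^sub>k) \<langle>1, e\<^sub>k\<rangle>\<close>, so that Parseval's
  identity is a quadrature formula with weights \<open>|\<langle>1, e\<^sub>k\<rangle>|\<^sup>2\<close> and the multiples \<open>\<langle>1, e\<^sub>k\<rangle> e\<^sub>k\<close> form
  the Lagrange basis of the nodes.\<close>

subsection \<open>The polynomial ring\<close>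

text \<open>The hypotheses control the form only in degree at most \<open>n + 1\<close>, so
  multiplications by variables cannot simply be iterated: a product leaves degree \<open>n\<close>
  and has to be replaced by a representative of degree at most \<open>n\<close> before the next
  factor is applied. No quotient space is formed; invariance, eigenvectors and commutation are all
  stated modulo null polynomials. A polynomial of degree \<open>n + 1\<close> is null as soon as it
  pairs to zero with degree \<open>n\<close>, which leaves room to move one variable to the other
  side of the form. Dimension theory is replaced by counting: orthonormal families have length at
  most \<open>r\<close>, so longest ones exist, and these span up to null polynomials. Uniqueness of
  the measure uses that a null polynomial \<open>p\<close> satisfies
  \<open>\<integral> |p|\<^sup>2 = 0\<close>. Every representing measure therefore lives on the
  common zeros of the null polynomials, and the integrals of the Lagrange basis fix its masses. The
  extra degree is used once more here: the polynomials cutting out the nodes are products of a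
  Lagrange polynomial and a linear factor.\<close>

definition pconst :: "complex \<Rightarrow> 'd::finite zpoly" where
  "pconst c = Poly_Mapping.single 0 c"

lemma pconst_hom [simp]:
  "pconst 0 = 0" "pconst 1 = 1"
  by (simp_all add: pconst_def)

lemma pconst_add: "pconst (a + b) = pconst a + pconst b"
  by (simp add: pconst_def single_add)

lemma pconst_mult: "pconst (a * b) = pconst a * pconst b"
  by (simp add: pconst_def mult_single)

lemma pconst_uminus: "pconst (- a) = - pconst a"
  by (simp add: pconst_def single_uminus)

lemma pconst_sum: "pconst (sum f A) = (\<Sum>i\<in>A. pconst (f i))"
  by (induction A rule: infinite_finite_induct) (simp_all add: pconst_add)

lemma lookup_pconst_mult: "Poly_Mapping.lookup (pconst c * p) m = c * Poly_Mapping.lookup p m"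
proof -
  have "pconst c * p = Poly_Mapping.map ((*) c) p"
    by (simp add: pconst_def mult_map_scale_conv_mult)
  then show ?thesis
    by (simp add: Poly_Mapping.map.rep_eq when_def)
qed

lemma mono_degree_add: "mono_degree (m + m') = mono_degree m + mono_degree m'"
  by (simp add: mono_degree_def sum.distrib)

lemma mono_degree_swap [simp]: "mono_degree (prod.swap m) = mono_degree m"
  by (simp add: mono_degree_def)

lemma swap_add: "prod.swap (m + m') = prod.swap m + prod.swap m'"
  by (simp add: prod_eq_iff)

lemma swap_zero [simp]: "prod.swap 0 = 0"
  by (simp add: prod_eq_iff)

lemma mono_degree_zero [simp]: "mono_degree 0 = 0"
  by (simp add: mono_degree_def)

lemma poly_spaceI:
  assumes "\<And>m. l < mono_degree m \<Longrightarrow> Poly_Mapping.lookup p m = 0"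
  shows "p \<in> poly_space l"
  using assms by (auto simp: poly_space_def in_keys_iff not_le[symmetric])

lemma poly_spaceD:
  "p \<in> poly_space l \<Longrightarrow> l < mono_degree m \<Longrightarrow> Poly_Mapping.lookup p m = 0"
  by (auto simp: poly_space_def in_keys_iff not_le[symmetric])

lemma poly_space_zero [simp]: "0 \<in> poly_space l"
  by (simp add: poly_space_def)

lemma poly_space_one [simp]: "1 \<in> poly_space l"
  by (simp add: poly_space_def)

lemma poly_space_add: "p \<in> poly_space l \<Longrightarrow> q \<in> poly_space l \<Longrightarrow> p + q \<in> poly_space l"
  by (auto intro!: poly_spaceI simp: lookup_add poly_spaceD)

lemma poly_space_diff: "p \<in> poly_space l \<Longrightarrow> q \<in> poly_space l \<Longrightarrow> p - q \<in> poly_space l"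
  by (auto intro!: poly_spaceI simp: lookup_minus poly_spaceD)

lemma poly_space_sum: "(\<And>i. i \<in> A \<Longrightarrow> f i \<in> poly_space l) \<Longrightarrow> sum f A \<in> poly_space l"
  by (induction A rule: infinite_finite_induct) (auto intro: poly_space_add)

lemma poly_space_pconst_mult: "p \<in> poly_space l \<Longrightarrow> pconst c * p \<in> poly_space l"
  by (auto intro!: poly_spaceI simp: lookup_pconst_mult poly_spaceD)

lemma poly_space_mono: "p \<in> poly_space l \<Longrightarrow> l \<le> l' \<Longrightarrow> p \<in> poly_space l'"
  by (fastforce simp: poly_space_def)

lemma poly_space_zmonom: "mono_degree m \<le> l \<Longrightarrow> zmonom m \<in> poly_space l"
  by (simp add: poly_space_def zmonom_def)

lemma poly_space_mult: "p \<in> poly_space l \<Longrightarrow> q \<in> poly_space l' \<Longrightarrow> p * q \<in> poly_space (l + l')"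
proof -
  assume p: "p \<in> poly_space l" and q: "q \<in> poly_space l'"
  have "mono_degree m \<le> l + l'" if m: "m \<in> Poly_Mapping.keys (p * q)" for m
  proof -
    obtain a b where "m = a + b" "a \<in> Poly_Mapping.keys p" "b \<in> Poly_Mapping.keys q"
      using subsetD[OF keys_mult m] by auto
    then show ?thesis using p q by (auto simp: poly_space_def mono_degree_add intro: add_mono)
  qed
  then show ?thesis by (simp add: poly_space_def)
qed

lemma poly_space_zmonom_mult:
  "mono_degree m = 1 \<Longrightarrow> p \<in> poly_space l \<Longrightarrow> zmonom m * p \<in> poly_space (Suc l)"
  using poly_space_mult[OF poly_space_zmonom[of m 1], of p l] by simp

lemma zpoly_eq_sum_zmonom:
  "p = (\<Sum>m\<in>Poly_Mapping.keys p. pconst (Poly_Mapping.lookup p m) * zmonom m)"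
  using zpoly_expand[of "Poly_Mapping.keys p" p]
  by (simp add: pconst_def zmonom_def mult_single)

lemma conj_poly_mult: "conj_poly (p * q) = conj_poly p * conj_poly q"
proof -
  let ?P = "Poly_Mapping.keys p" and ?Q = "Poly_Mapping.keys q"
  have "p * q = (\<Sum>m\<in>?P. \<Sum>m'\<in>?Q. Poly_Mapping.single (m + m')
      (Poly_Mapping.lookup p m * Poly_Mapping.lookup q m'))"
    by (subst zpoly_expand[of ?P p], simp, simp, subst zpoly_expand[of ?Q q])
      (simp_all add: sum_product mult_single)
  moreover have "conj_poly p * conj_poly q = (\<Sum>m\<in>?P. \<Sum>m'\<in>?Q. Poly_Mapping.single
      (prod.swap (m + m')) (cnj (Poly_Mapping.lookup p m * Poly_Mapping.lookup q m')))"
    by (subst zpoly_expand[of ?P p], simp, simp, subst zpoly_expand[of ?Q q])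
      (simp_all add: sum_product mult_single conj_poly_sum conj_poly_single swap_add)
  ultimately show ?thesis by (simp add: conj_poly_sum conj_poly_single)
qed

lemma conj_poly_pconst: "conj_poly (pconst c) = pconst (cnj c)"
  by (simp add: pconst_def conj_poly_single)

lemma conj_poly_one [simp]: "conj_poly 1 = 1"
  using conj_poly_pconst[of 1] by simp

lemma conj_poly_zmonom: "conj_poly (zmonom m) = zmonom (prod.swap m)"
  by (simp add: zmonom_def conj_poly_single)

lemma riesz_pconst_mult: "riesz \<gamma> (pconst c * p) = c * riesz \<gamma> p"
proof -
  have "Poly_Mapping.keys (pconst c * p) \<subseteq> Poly_Mapping.keys p"
    by (auto simp: in_keys_iff lookup_pconst_mult)
  then show ?thesis
    by (simp add: riesz_superset[of "Poly_Mapping.keys p" "pconst c * p"] lookup_pconst_mult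
        riesz_superset[of "Poly_Mapping.keys p" p] sum_distrib_left mult.assoc)
qed

lemma riesz_zmonom: "riesz \<gamma> (zmonom m) = \<gamma> (fst m) (snd m)"
  by (simp add: zmonom_def riesz_single)

lemma riesz_cong:
  assumes "p \<in> poly_space l" "\<And>i j. mono_degree (i, j) \<le> l \<Longrightarrow> \<gamma> i j = \<gamma>' i j"
  shows "riesz \<gamma> p = riesz \<gamma>' p"
  using assms unfolding riesz_def poly_space_def by (intro sum.cong) auto

subsection \<open>Evaluation\<close>

lemma mono_eval_add: "mono_eval (m + m') z = mono_eval m z * mono_eval m' z"
  by (simp add: mono_eval_def power_add prod.distrib)

lemma mono_eval_swap: "mono_eval (prod.swap m) z = cnj (mono_eval m z)"
  by (simp add: mono_eval_def)

lemma mono_eval_zero [simp]: "mono_eval 0 z = 1"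
  by (simp add: mono_eval_def)

lemma poly_eval_eq_riesz: "poly_eval p z = riesz (\<lambda>i j. mono_eval (i, j) z) p"
  by (simp add: poly_eval_def riesz_def)

lemma poly_eval_add: "poly_eval (p + q) z = poly_eval p z + poly_eval q z"
  by (simp add: poly_eval_eq_riesz riesz_add)

lemma poly_eval_sum: "poly_eval (sum f A) z = (\<Sum>i\<in>A. poly_eval (f i) z)"
  by (simp add: poly_eval_eq_riesz riesz_sum)

lemma poly_eval_pconst_mult: "poly_eval (pconst c * p) z = c * poly_eval p z"
  by (simp add: poly_eval_eq_riesz riesz_pconst_mult)

lemma poly_eval_zmonom: "poly_eval (zmonom m) z = mono_eval m z"
  by (simp add: poly_eval_eq_riesz riesz_zmonom)

lemma poly_eval_zero [simp]: "poly_eval 0 z = 0"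
  by (simp add: poly_eval_def)

lemma poly_eval_one [simp]: "poly_eval 1 z = 1"
  by (simp add: poly_eval_def lookup_one)

lemma poly_eval_pconst [simp]: "poly_eval (pconst c) z = c"
  using poly_eval_pconst_mult[of c 1 z] by simp

lemma poly_eval_uminus: "poly_eval (- p) z = - poly_eval p z"
  using poly_eval_add[of p "- p" z] by (simp add: add_eq_0_iff)

lemma poly_eval_diff: "poly_eval (p - q) z = poly_eval p z - poly_eval q z"
  using poly_eval_add[of p "- q" z] by (simp add: poly_eval_uminus)

lemma poly_eval_zmonom_mult: "poly_eval (zmonom m * q) z = mono_eval m z * poly_eval q z"
proof -
  have "zmonom m * q = (\<Sum>m'\<in>Poly_Mapping.keys q. pconst (Poly_Mapping.lookup q m') * zmonom (m + m'))"
    by (subst zpoly_eq_sum_zmonom[of q])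
      (simp add: sum_distrib_left zmonom_def pconst_def mult_single)
  then have "poly_eval (zmonom m * q) z =
      poly_eval (\<Sum>m'\<in>Poly_Mapping.keys q. pconst (Poly_Mapping.lookup q m') * zmonom (m + m')) z"
    by simp
  then show ?thesis
    by (simp add: poly_eval_sum poly_eval_pconst_mult poly_eval_zmonom mono_eval_add
        poly_eval_def[of q] sum_distrib_left mult.left_commute)
qed

lemma poly_eval_mult: "poly_eval (p * q) z = poly_eval p z * poly_eval q z"
proof -
  have "p * q = (\<Sum>m\<in>Poly_Mapping.keys p. pconst (Poly_Mapping.lookup p m) * (zmonom m * q))"
    by (subst zpoly_eq_sum_zmonom[of p]) (simp add: sum_distrib_right mult.assoc)
  then show ?thesis
    by (simp add: poly_eval_sum poly_eval_pconst_mult poly_eval_zmonom_mult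
        poly_eval_def[of p] sum_distrib_right mult.assoc)
qed

lemma poly_eval_conj: "poly_eval (conj_poly p) z = cnj (poly_eval p z)"
proof -
  have "conj_poly p = (\<Sum>m\<in>Poly_Mapping.keys p.
      pconst (cnj (Poly_Mapping.lookup p m)) * zmonom (prod.swap m))"
    by (subst zpoly_eq_sum_zmonom[of p])
      (simp add: conj_poly_sum conj_poly_mult conj_poly_pconst conj_poly_zmonom)
  then show ?thesis
    by (simp add: poly_eval_sum poly_eval_pconst_mult poly_eval_zmonom mono_eval_swap
        poly_eval_def[of p])
qed

lemma mono_degree_axis [simp]:
  "mono_degree (0, axis k (Suc 0)) = Suc 0" "mono_degree (axis k (Suc 0), 0) = Suc 0"
  by (simp_all add: mono_degree_def axis_def sum.delta)

lemma mono_eval_axis [simp]: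
  "mono_eval (0, axis k (Suc 0)) z = z $ k" "mono_eval (axis k (Suc 0), 0) z = cnj (z $ k)"
proof -
  have "(\<Prod>i\<in>UNIV. f (z $ i) ^ (axis k (Suc 0) $ i)) = f (z $ k)" for f :: "complex \<Rightarrow> complex"
  proof -
    have "(\<Prod>i\<in>UNIV. f (z $ i) ^ (axis k (Suc 0) $ i)) = (\<Prod>i\<in>UNIV. if i = k then f (z $ i) else 1)"
      by (intro prod.cong) (auto simp: axis_def)
    then show ?thesis by (simp add: prod.delta)
  qed
  from this[of "\<lambda>x. x"] this[of cnj]
  show "mono_eval (0, axis k (Suc 0)) z = z $ k" "mono_eval (axis k (Suc 0), 0) z = cnj (z $ k)"
    by (simp_all add: mono_eval_def)
qed

section \<open>Splitting monomials by degree\<close>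

lemma mono_split_variable:
  fixes m :: "'d::finite mono"
  assumes "mono_degree m = Suc l"
  obtains k m' where "m = (0, axis k (Suc 0)) + m' \<or> m = (axis k (Suc 0), 0) + m'" "mono_degree m' = l"
proof -
  obtain i j where m: "m = (i, j)" by (cases m)
  have sub: "x = axis k (Suc 0) + (x - axis k (Suc 0))" if "x $ k \<noteq> 0" for x :: "nat ^ 'd" and k
    using that by (simp add: Finite_Cartesian_Product.vec_eq_iff axis_def)
  have "(\<exists>k. i $ k \<noteq> 0) \<or> (\<exists>k. j $ k \<noteq> 0)"
  proof (rule ccontr)
    assume "\<not> ?thesis"
    then show False using assms by (simp add: m mono_degree_def)
  qed
  then show thesis
  proof
    assume "\<exists>k. i $ k \<noteq> 0"
    then obtain k where "i $ k \<noteq> 0" by blast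
    then have eq: "m = (axis k (Suc 0), 0) + (i - axis k (Suc 0), j)" using sub[of i k] by (simp add: m)
    from arg_cong[OF eq, of mono_degree] assms
    have "mono_degree (i - axis k (Suc 0), j) = l" by (simp only: mono_degree_add mono_degree_axis)
    with eq that show thesis by blast
  next
    assume "\<exists>k. j $ k \<noteq> 0"
    then obtain k where "j $ k \<noteq> 0" by blast
    then have eq: "m = (0, axis k (Suc 0)) + (i, j - axis k (Suc 0))" using sub[of j k] by (simp add: m)
    from arg_cong[OF eq, of mono_degree] assms
    have "mono_degree (i, j - axis k (Suc 0)) = l" by (simp only: mono_degree_add mono_degree_axis)
    with eq that show thesis by blast
  qed
qed

lemma mono_degree_eq_0: "mono_degree m = 0 \<longleftrightarrow> m = 0"
  by (auto simp: mono_degree_def prod_eq_iff Finite_Cartesian_Product.vec_eq_iff)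

lemma mono_degree_oneE:
  assumes "mono_degree m = 1"
  obtains k where "m = (0, axis k (Suc 0))" | k where "m = (axis k (Suc 0), 0)"
proof -
  obtain k m' where "m = (0, axis k (Suc 0)) + m' \<or> m = (axis k (Suc 0), 0) + m'" "mono_degree m' = 0"
    using mono_split_variable[of m 0] assms by (metis One_nat_def)
  then show thesis using that by (auto simp: mono_degree_eq_0)
qed

lemma mono_degree_split:
  assumes "mono_degree m = Suc l"
  obtains m1 m2 where "m = m1 + m2" "mono_degree m1 = 1" "mono_degree m2 = l"
  using mono_split_variable[OF assms] by (metis One_nat_def mono_degree_axis)

text \<open>With both bounds equal to \<open>n + 1\<close>, this turns every moment of degree at
  most \<open>2 * n + 2\<close> into a value of the form on two monomials.\<close>

lemma mono_degree_split2:
  assumes "mono_degree m \<le> k + l"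
  obtains m1 m2 where "m = m1 + m2" "mono_degree m1 \<le> k" "mono_degree m2 \<le> l"
proof -
  have "\<exists>m1 m2. m = m1 + m2 \<and> mono_degree m1 = a" if "a \<le> mono_degree m" for a
    using that
  proof (induction a arbitrary: m)
    case 0
    then show ?case by (intro exI[of _ 0] exI[of _ m]) auto
  next
    case (Suc a)
    then obtain b where b: "mono_degree m = Suc b" by (cases "mono_degree m") auto
    obtain x y where xy: "m = x + y" "mono_degree x = 1" "mono_degree y = b"
      by (rule mono_degree_split[OF b])
    with Suc b obtain p q where "y = p + q" "mono_degree p = a" by fastforce
    with xy show ?case
      by (intro exI[of _ "x + p"] exI[of _ q]) (simp add: mono_degree_add add.assoc)
  qed
  from this[of "min k (mono_degree m)"] obtain m1 m2
    where "m = m1 + m2" "mono_degree m1 = min k (mono_degree m)" by auto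
  then show thesis using assms by (intro that[of m1 m2]) (auto simp: mono_degree_add)
qed

text \<open>There are fewer equations than unknowns. The system is padded with zero rows to a square
  matrix so that the determinant criterion for kernel vectors applies. Both counting arguments below
  rest on this.\<close>

lemma exists_nontrivial_relation:
  fixes a :: "nat \<Rightarrow> nat \<Rightarrow> 'a::field"
  assumes "s < r"
  obtains c where "\<exists>i<r. c i \<noteq> 0" "\<And>k. k < s \<Longrightarrow> (\<Sum>i<r. c i * a i k) = 0"
proof -
  define A where "A = Matrix.mat r r (\<lambda>(k, i). if k < s then a i k else 0)"
  have A: "A \<in> carrier_mat r r" by (simp add: A_def)
  \<comment> \<open>Row \<open>s\<close> of \<open>A\<close> is a padding row, which exists because
    \<open>s < r\<close>; it makes the transpose singular, and with it \<open>A\<close>.\<close>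
  have "transpose_mat A *\<^sub>v unit_vec r s = 0\<^sub>v r"
    using assms by (intro eq_vecI) (auto simp: A_def scalar_prod_right_unit)
  then have "det (transpose_mat A) = 0"
    using det_0_iff_vec_prod_zero[of "transpose_mat A" r] A assms
    by (metis transpose_carrier_mat unit_vec_carrier unit_vec_nonzero)
  then have "det A = 0" using det_transpose[OF A] by simp
  then obtain v where v: "v \<in> carrier_vec r" "v \<noteq> 0\<^sub>v r" "A *\<^sub>v v = 0\<^sub>v r"
    using det_0_iff_vec_prod_zero[OF A] by blast
  show thesis
  proof (rule that[of "vec_index v"])
    show "\<exists>i<r. vec_index v i \<noteq> 0"
      using v(1,2) by (metis carrier_vecD eq_vecI index_zero_vec)
    fix k assume k: "k < s"
    then have "vec_index (A *\<^sub>v v) k = 0" using v assms by simp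
    then show "(\<Sum>i<r. vec_index v i * a i k) = 0"
      using k assms v(1) by (simp add: A_def scalar_prod_def atLeast0LessThan mult.commute)
  qed
qed

subsection \<open>The sesquilinear form of a moment sequence\<close>

definition moment_form ::
  "(nat ^ 'd::finite \<Rightarrow> nat ^ 'd \<Rightarrow> complex) \<Rightarrow> 'd zpoly \<Rightarrow> 'd zpoly \<Rightarrow> complex" where
  "moment_form \<gamma> f g = riesz \<gamma> (f * conj_poly g)"

text \<open>The radical of the form in degree at most \<open>l\<close>. It consists of the
  polynomials whose combination of columns of the moment matrix vanishes
  (\<open>null_polys_iff_poly_col\<close>).\<close>

definition null_polys ::
  "nat \<Rightarrow> (nat ^ 'd::finite \<Rightarrow> nat ^ 'd \<Rightarrow> complex) \<Rightarrow> 'd zpoly set" where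
  "null_polys l \<gamma> = {p \<in> poly_space l. \<forall>g\<in>poly_space l. moment_form \<gamma> p g = 0}"

lemma moment_form_add_left: "moment_form \<gamma> (f + f') g = moment_form \<gamma> f g + moment_form \<gamma> f' g"
  by (simp add: moment_form_def distrib_right riesz_add)

lemma moment_form_add_right: "moment_form \<gamma> f (g + g') = moment_form \<gamma> f g + moment_form \<gamma> f g'"
  by (simp add: moment_form_def distrib_left riesz_add conj_poly_add)

lemma moment_form_pconst_left: "moment_form \<gamma> (pconst c * f) g = c * moment_form \<gamma> f g"
  by (simp add: moment_form_def mult.assoc riesz_pconst_mult)

lemma moment_form_pconst_right: "moment_form \<gamma> f (pconst c * g) = cnj c * moment_form \<gamma> f g"
  by (simp add: moment_form_def conj_poly_mult conj_poly_pconst mult.left_commute[of f] riesz_pconst_mult)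

lemma moment_form_diff_left: "moment_form \<gamma> (f - f') g = moment_form \<gamma> f g - moment_form \<gamma> f' g"
  using moment_form_add_left[of \<gamma> f "pconst (-1) * f'" g]
  by (simp only: moment_form_pconst_left) (simp add: pconst_uminus)

lemma moment_form_diff_right: "moment_form \<gamma> f (g - g') = moment_form \<gamma> f g - moment_form \<gamma> f g'"
  using moment_form_add_right[of \<gamma> f g "pconst (-1) * g'"]
  by (simp only: moment_form_pconst_right) (simp add: pconst_uminus)

lemma moment_form_zero_left [simp]: "moment_form \<gamma> 0 g = 0"
  using moment_form_diff_left[of \<gamma> 0 0 g] by simp

lemma moment_form_zero_right [simp]: "moment_form \<gamma> f 0 = 0"
  using moment_form_diff_right[of \<gamma> f 0 0] by simp

lemma moment_form_sum_left: "moment_form \<gamma> (sum f A) g = (\<Sum>i\<in>A. moment_form \<gamma> (f i) g)"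
  by (induction A rule: infinite_finite_induct) (simp_all add: moment_form_add_left)

lemma moment_form_sum_right: "moment_form \<gamma> f (sum g A) = (\<Sum>i\<in>A. moment_form \<gamma> f (g i))"
  by (induction A rule: infinite_finite_induct) (simp_all add: moment_form_add_right)

text \<open>Both sides are \<open>riesz\<close> of the same product, so no degree bound enters. This
  is the adjointness of multiplication by a variable and by its conjugate.\<close>

lemma moment_form_zmonom_left:
  "moment_form \<gamma> (zmonom m * f) g = moment_form \<gamma> f (zmonom (prod.swap m) * g)"
  by (simp add: moment_form_def conj_poly_mult conj_poly_zmonom mult_ac)

lemma null_polys_in_space: "p \<in> null_polys l \<gamma> \<Longrightarrow> p \<in> poly_space l"
  by (simp add: null_polys_def)

lemma null_polysD: "p \<in> null_polys l \<gamma> \<Longrightarrow> g \<in> poly_space l \<Longrightarrow> moment_form \<gamma> p g = 0"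
  by (simp add: null_polys_def)

lemma null_polys_zero [simp]: "0 \<in> null_polys l \<gamma>"
  by (simp add: null_polys_def)

lemma null_polys_add: "p \<in> null_polys l \<gamma> \<Longrightarrow> q \<in> null_polys l \<gamma> \<Longrightarrow> p + q \<in> null_polys l \<gamma>"
  by (simp add: null_polys_def poly_space_add moment_form_add_left)

lemma null_polys_pconst_mult: "p \<in> null_polys l \<gamma> \<Longrightarrow> pconst c * p \<in> null_polys l \<gamma>"
  by (simp add: null_polys_def poly_space_pconst_mult moment_form_pconst_left)

lemma null_polys_sum: "(\<And>i. i \<in> A \<Longrightarrow> f i \<in> null_polys l \<gamma>) \<Longrightarrow> sum f A \<in> null_polys l \<gamma>"
  by (induction A rule: infinite_finite_induct) (auto intro: null_polys_add)

text \<open>The family \<open>b\<close> is a basis of \<open>poly_space (Suc n)\<close> modulo the null space that already lies in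
  \<open>poly_space n\<close>: this is what flatness of the extension provides.\<close>

locale flat_form =
  fixes n r :: nat
    and \<gamma> :: "nat ^ 'd::finite \<Rightarrow> nat ^ 'd \<Rightarrow> complex"
    and b :: "nat \<Rightarrow> 'd zpoly"
  assumes hermitian: "\<And>f g. f \<in> poly_space (Suc n) \<Longrightarrow> g \<in> poly_space (Suc n) \<Longrightarrow>
      moment_form \<gamma> g f = cnj (moment_form \<gamma> f g)"
    and nonneg: "\<And>f. f \<in> poly_space (Suc n) \<Longrightarrow> 0 \<le> Re (moment_form \<gamma> f f)"
    and basis_mem: "\<And>i. i < r \<Longrightarrow> b i \<in> poly_space n"
    and basis_indep: "\<And>a i. (\<Sum>i<r. pconst (a i) * b i) \<in> null_polys (Suc n) \<gamma> \<Longrightarrow> i < r \<Longrightarrow> a i = 0"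
    and basis_span: "\<And>f. f \<in> poly_space (Suc n) \<Longrightarrow>
      \<exists>a. f - (\<Sum>i<r. pconst (a i) * b i) \<in> null_polys (Suc n) \<gamma>"
begin

abbreviation P :: "'d zpoly set" where "P \<equiv> poly_space (Suc n)"
abbreviation K :: "'d zpoly set" where "K \<equiv> null_polys (Suc n) \<gamma>"
abbreviation ip :: "'d zpoly \<Rightarrow> 'd zpoly \<Rightarrow> complex" where "ip \<equiv> moment_form \<gamma>"

lemma poly_space_n_subset: "f \<in> poly_space n \<Longrightarrow> f \<in> P"
  by (rule poly_space_mono) auto

lemma null_right: "p \<in> K \<Longrightarrow> g \<in> P \<Longrightarrow> ip g p = 0"
  using hermitian[of p g] by (simp add: null_polysD null_polys_in_space)

lemma ip_self_real: "f \<in> P \<Longrightarrow> ip f f = of_real (Re (ip f f))"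
  using hermitian[of f f] by (simp add: complex_eq_iff)

text \<open>The degenerate case of Cauchy-Schwarz: if \<open>ip f g\<close> were nonzero, adding a
  small multiple of \<open>g\<close> to \<open>f\<close> would make the form negative.\<close>

lemma null_if_ip_self_zero:
  assumes f: "f \<in> P" and z: "ip f f = 0"
  shows "f \<in> K"
proof -
  have "ip f g = 0" if g: "g \<in> P" for g
  proof (rule ccontr)
    assume nz: "ip f g \<noteq> 0"
    define G where "G = Re (ip g g)"
    have G: "ip g g = of_real G" "0 \<le> G" using ip_self_real[OF g] nonneg[OF g] by (simp_all add: G_def)
    \<comment> \<open>\<open>G\<close> may be zero, hence the \<open>+ 1\<close>. The bound
      \<open>\<epsilon> * G < 1\<close> keeps the quadratic term below the linear one.\<close>
    define \<epsilon> where "\<epsilon> = 1 / (G + 1)"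
    have \<epsilon>: "0 < \<epsilon>" "\<epsilon> * G < 1" using G(2) by (auto simp: \<epsilon>_def field_simps)
    \<comment> \<open>With this phase each of the two cross terms of \<open>ip h h\<close> equals
      \<open>- \<epsilon> * (cmod (ip f g))\<^sup>2\<close>.\<close>
    define t where "t = - of_real \<epsilon> * ip f g"
    define h where "h = f + pconst t * g"
    have "ip h h = cnj t * ip f g + t * cnj (ip f g) + t * cnj t * of_real G"
      using z G(1) hermitian[OF f g]
      by (simp add: h_def moment_form_add_left moment_form_add_right moment_form_pconst_left
          moment_form_pconst_right distrib_left)
    also have "\<dots> = of_real (\<epsilon> * (\<epsilon> * G - 2) * (cmod (ip f g))\<^sup>2)"
      unfolding t_def of_real_mult complex_norm_square by (simp add: algebra_simps)
    finally have "Re (ip h h) = \<epsilon> * (\<epsilon> * G - 2) * (cmod (ip f g))\<^sup>2" by simp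
    moreover have "\<epsilon> * (\<epsilon> * G - 2) * (cmod (ip f g))\<^sup>2 < 0"
      using \<epsilon> nz by (intro mult_neg_pos mult_pos_neg) auto
    ultimately show False
      using nonneg[of h] f g by (simp add: h_def poly_space_add poly_space_pconst_mult)
  qed
  then show ?thesis using f by (simp add: null_polys_def)
qed

lemma reduce:
  assumes "f \<in> P"
  obtains g where "g \<in> poly_space n" "f - g \<in> K"
proof -
  obtain a where "f - (\<Sum>i<r. pconst (a i) * b i) \<in> K" using basis_span[OF assms] by blast
  then show thesis
    by (rule that[rotated]) (auto intro: poly_space_sum poly_space_pconst_mult basis_mem)
qed

text \<open>By flatness \<open>f\<close> differs from some \<open>g\<close> of degree at most
  \<open>n\<close> by a null polynomial, so \<open>ip f f = ip f g\<close>. Test polynomials of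
  degree \<open>n\<close> can still absorb one variable without leaving \<open>P\<close>.\<close>

lemma nullI:
  assumes f: "f \<in> P" and z: "\<And>g. g \<in> poly_space n \<Longrightarrow> ip f g = 0"
  shows "f \<in> K"
proof -
  obtain g where g: "g \<in> poly_space n" "f - g \<in> K" using reduce[OF f] .
  have "ip f f = ip f g + ip f (f - g)" by (simp add: moment_form_diff_right)
  also have "\<dots> = 0" using z[OF g(1)] null_right[OF g(2) f] by simp
  finally show ?thesis by (rule null_if_ip_self_zero[OF f])
qed

subsection \<open>Orthonormal families\<close>

definition orthonormal :: "'d zpoly set \<Rightarrow> nat \<Rightarrow> (nat \<Rightarrow> 'd zpoly) \<Rightarrow> bool" where
  "orthonormal U s e \<longleftrightarrow> (\<forall>i<s. e i \<in> U) \<and> (\<forall>i<s. \<forall>j<s. ip (e i) (e j) = (if i = j then 1 else 0))"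

definition proj :: "nat \<Rightarrow> (nat \<Rightarrow> 'd zpoly) \<Rightarrow> 'd zpoly \<Rightarrow> 'd zpoly" where
  "proj s e f = (\<Sum>i<s. pconst (ip f (e i)) * e i)"

text \<open>The bound is \<open>n\<close>, not \<open>n + 1\<close>, so that multiplying an element
  by a variable stays inside \<open>P\<close>.\<close>

definition subsp :: "'d zpoly set \<Rightarrow> bool" where
  "subsp U \<longleftrightarrow> U \<subseteq> poly_space n \<and> 0 \<in> U \<and> (\<forall>f\<in>U. \<forall>g\<in>U. f + g \<in> U) \<and> (\<forall>f\<in>U. \<forall>c. pconst c * f \<in> U)"

lemma subsp_poly_space: "subsp (poly_space n)"
  by (simp add: subsp_def poly_space_add poly_space_pconst_mult)

lemma subsp_sum: "subsp U \<Longrightarrow> (\<And>i. i \<in> A \<Longrightarrow> f i \<in> U) \<Longrightarrow> sum f A \<in> U"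
  by (induction A rule: infinite_finite_induct) (auto simp: subsp_def)

lemma subsp_diff:
  assumes "subsp U" "f \<in> U" "g \<in> U" shows "f - g \<in> U"
proof -
  have "f + pconst (-1) * g \<in> U" using assms by (simp add: subsp_def)
  then show ?thesis by (simp add: pconst_uminus)
qed

lemma orthonormal_ip_sum:
  assumes "orthonormal U s e" "k < s"
  shows "ip (\<Sum>i<s. pconst (c i) * e i) (e k) = c k"
proof -
  have "ip (\<Sum>i<s. pconst (c i) * e i) (e k) = (\<Sum>i<s. if i = k then c i else 0)"
    unfolding moment_form_sum_left moment_form_pconst_left
    using assms by (intro sum.cong) (auto simp: orthonormal_def)
  then show ?thesis using assms by simp
qed

text \<open>If \<open>s\<close> exceeded \<open>r'\<close>, the coordinate vectors of the
  \<open>e i\<close> would satisfy a nontrivial relation. The same combination of the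
  \<open>e i\<close> would be null, and pairing it with each \<open>e k\<close> returns the
  coefficient \<open>c k\<close>, which would be zero.\<close>

lemma orthonormal_length_le:
  assumes on: "orthonormal U s e" and U: "U \<subseteq> poly_space n"
    and span: "\<And>f. f \<in> U \<Longrightarrow> \<exists>a. f - (\<Sum>i<r'. pconst (a i) * b' i) \<in> K"
  shows "s \<le> r'"
proof (rule ccontr)
  assume "\<not> s \<le> r'"
  then have lt: "r' < s" by simp
  have "\<forall>i\<in>{..<s}. \<exists>a. e i - (\<Sum>k<r'. pconst (a k) * b' k) \<in> K"
  proof
    fix i assume "i \<in> {..<s}"
    then show "\<exists>a. e i - (\<Sum>k<r'. pconst (a k) * b' k) \<in> K"
      using on by (intro span) (simp add: orthonormal_def)
  qed
  from bchoice[OF this] obtain a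
    where a: "\<And>i. i < s \<Longrightarrow> e i - (\<Sum>k<r'. pconst (a i k) * b' k) \<in> K"
    by blast
  obtain c where c: "\<exists>i<s. c i \<noteq> 0" "\<And>k. k < r' \<Longrightarrow> (\<Sum>i<s. c i * a i k) = 0"
    using exists_nontrivial_relation[OF lt, of a] by blast
  have "(\<Sum>i<s. pconst (c i) * (\<Sum>k<r'. pconst (a i k) * b' k)) = 
      (\<Sum>k<r'. pconst (\<Sum>i<s. c i * a i k) * b' k)"
    unfolding sum_distrib_left pconst_sum sum_distrib_right pconst_mult
    by (subst sum.swap) (simp add: mult.assoc)
  also have "\<dots> = 0" using c(2) by simp
  finally have "(\<Sum>i<s. pconst (c i) * e i) =
      (\<Sum>i<s. pconst (c i) * (e i - (\<Sum>k<r'. pconst (a i k) * b' k)))"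
    by (simp add: right_diff_distrib sum_subtractf)
  also have "\<dots> \<in> K" using a by (intro null_polys_sum null_polys_pconst_mult) auto
  finally have cK: "(\<Sum>i<s. pconst (c i) * e i) \<in> K" .
  have "ip (\<Sum>i<s. pconst (c i) * e i) (e k) = 0" if "k < s" for k
  proof (rule null_polysD[OF cK])
    show "e k \<in> P" using on U that by (auto simp: orthonormal_def intro: poly_space_n_subset)
  qed
  moreover obtain k where "k < s" "c k \<noteq> 0" using c(1) by blast
  ultimately show False using orthonormal_ip_sum[OF on, of k c] by simp
qed

lemma orthonormal_length_le_r:
  assumes "orthonormal U s e" "U \<subseteq> poly_space n"
  shows "s \<le> r"
proof (rule orthonormal_length_le[OF assms])
  fix f assume "f \<in> U"
  then show "\<exists>a. f - (\<Sum>i<r. pconst (a i) * b i) \<in> K"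
    using assms(2) by (intro basis_span poly_space_n_subset) auto
qed

lemma proj_mem: "subsp U \<Longrightarrow> orthonormal U s e \<Longrightarrow> proj s e f \<in> U"
  unfolding proj_def by (rule subsp_sum) (auto simp: orthonormal_def subsp_def)

lemma ip_proj: "orthonormal U s e \<Longrightarrow> k < s \<Longrightarrow> ip (proj s e f) (e k) = ip f (e k)"
  unfolding proj_def by (rule orthonormal_ip_sum)

lemma orthonormal_extend:
  assumes on: "orthonormal U s e" and U: "U \<subseteq> P"
    and f: "f \<in> P" "f \<notin> K" and orth: "\<And>i. i < s \<Longrightarrow> ip f (e i) = 0"
    and mem: "\<And>c. pconst c * f \<in> U"
  obtains c where "c \<noteq> 0" "orthonormal U (Suc s) (e(s := pconst c * f))"
proof -
  define N where "N = Re (ip f f)"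
  have N: "ip f f = of_real N" "0 < N"
    using ip_self_real[OF f(1)] nonneg[OF f(1)] null_if_ip_self_zero[OF f(1)] f(2)
    by (auto simp: N_def complex_eq_iff less_le)
  define c where "c = complex_of_real (1 / sqrt N)"
  have cc: "cnj c * (c * of_real N) = 1"
    using N(2) by (simp add: c_def flip: of_real_mult)
  have orth': "ip (e i) f = 0" if "i < s" for i
    using hermitian[of f "e i"] f orth[OF that] that on U by (auto simp: orthonormal_def)
  have "orthonormal U (Suc s) (e(s := pconst c * f))"
    using on mem orth orth' cc
    by (auto simp: orthonormal_def less_Suc_eq moment_form_pconst_left moment_form_pconst_right
        N(1) mult.left_commute)
  moreover have "c \<noteq> 0" using cc by auto
  ultimately show thesis using that by blast
qed

lemma ip_residual:
  assumes "orthonormal U s e" "i < s"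
  shows "ip (f - proj s e f) (e i) = 0"
  using assms by (simp add: moment_form_diff_left ip_proj)

text \<open>A longest orthonormal family in \<open>U\<close> exists because lengths are bounded by
  \<open>r\<close>. A residual outside \<open>K\<close> could be normalised and appended to
  it.\<close>

lemma obtain_orthonormal_basis:
  assumes U: "subsp U"
  obtains s e where "orthonormal U s e" "\<And>f. f \<in> U \<Longrightarrow> f - proj s e f \<in> K"
proof -
  have UP: "U \<subseteq> poly_space n" "U \<subseteq> P"
    using U by (auto simp: subsp_def intro: poly_space_n_subset)
  let ?Q = "\<lambda>s. \<exists>e. orthonormal U s e"
  have "?Q 0" by (simp add: orthonormal_def)
  moreover have "\<forall>s. ?Q s \<longrightarrow> s \<le> r" using orthonormal_length_le_r UP by blast
  ultimately obtain s where s: "?Q s" "\<And>s'. ?Q s' \<Longrightarrow> s' \<le> s"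
    using Nat.ex_has_greatest_nat[of ?Q 0 r] by blast
  then obtain e where e: "orthonormal U s e" by blast
  show thesis
  proof (rule that[OF e])
    fix f assume f: "f \<in> U"
    have rU: "f - proj s e f \<in> U" using subsp_diff[OF U f proj_mem[OF U e]] .
    show "f - proj s e f \<in> K"
    proof (rule ccontr)
      assume "f - proj s e f \<notin> K"
      moreover have "f - proj s e f \<in> P" using rU UP by blast
      moreover have "pconst c * (f - proj s e f) \<in> U" for c using rU U by (simp add: subsp_def)
      ultimately obtain c where "orthonormal U (Suc s) (e(s := pconst c * (f - proj s e f)))"
        using orthonormal_extend[OF e UP(2), of "f - proj s e f"] ip_residual[OF e] by blast
      then have "Suc s \<le> s" by (intro s(2)) (rule exI)
      then show False by simp
    qed
  qed
qed

end

text \<open>The interface between the spectral argument and everything about varieties, measures and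
  matrices. The \<open>h k\<close> are the Lagrange basis of the nodes. Since \<open>form_eq\<close>
  covers both arguments up to degree \<open>n + 1\<close>, it determines all moments up to degree
  \<open>2 * n + 2\<close>.\<close>

locale quadrature =
  fixes n r :: nat
    and \<gamma> :: "nat ^ 'd::finite \<Rightarrow> nat ^ 'd \<Rightarrow> complex"
    and \<omega> :: "nat \<Rightarrow> complex ^ 'd"
    and h :: "nat \<Rightarrow> 'd zpoly"
    and \<rho> :: "nat \<Rightarrow> real"
  assumes h_mem: "\<And>k. k < r \<Longrightarrow> h k \<in> poly_space n"
    and h_eval: "\<And>i k. i < r \<Longrightarrow> k < r \<Longrightarrow> poly_eval (h k) (\<omega> i) = (if i = k then 1 else 0)"
    and weight_pos: "\<And>k. k < r \<Longrightarrow> 0 < \<rho> k"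
    and form_eq: "\<And>f g. f \<in> poly_space (Suc n) \<Longrightarrow> g \<in> poly_space (Suc n) \<Longrightarrow>
      moment_form \<gamma> f g = (\<Sum>k<r. of_real (\<rho> k) * poly_eval f (\<omega> k) * cnj (poly_eval g (\<omega> k)))"

section \<open>Joint eigenvectors of the multiplication operators\<close>

context flat_form
begin

text \<open>Here \<open>f\<close> is only congruent to an element of \<open>U\<close>, as happens
  for products of degree \<open>n + 1\<close>. A null difference does not change inner products with
  the \<open>e i\<close>, so \<open>f\<close> and \<open>g\<close> have the same projection.\<close>

lemma residual_null:
  assumes on: "orthonormal U s e" and U: "U \<subseteq> P"
    and basis: "\<And>g. g \<in> U \<Longrightarrow> g - proj s e g \<in> K"
    and g: "g \<in> U" "f - g \<in> K"
  shows "f - proj s e f \<in> K"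
proof -
  have "ip g (e i) = ip f (e i)" if "i < s" for i
    using null_polysD[OF g(2), of "e i"] on U that
    by (auto simp: moment_form_diff_left orthonormal_def)
  then have "proj s e g = proj s e f" by (simp add: proj_def)
  then show ?thesis using null_polys_add[OF g(2) basis[OF g(1)]] by simp
qed

text \<open>The monomials of degree one are the variables and their conjugates. The product itself
  may have degree \<open>n + 1\<close>; only a representative \<open>v\<close> modulo
  \<open>K\<close> has to lie in \<open>U\<close>.\<close>

definition invariant :: "'d zpoly set \<Rightarrow> bool" where
  "invariant U \<longleftrightarrow> subsp U \<and>
     (\<forall>u\<in>U. \<forall>m. mono_degree m = 1 \<longrightarrow> (\<exists>v\<in>U. zmonom m * u - v \<in> K))"

lemma invariantE:
  assumes "invariant U" "u \<in> U" "mono_degree m = 1"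
  obtains v where "v \<in> U" "zmonom m * u - v \<in> K"
  using assms unfolding invariant_def by blast

text \<open>Modulo \<open>K\<close> the multiplication acts on a nonzero finite-dimensional space,
  so its matrix in an orthonormal basis has a complex eigenvalue; the eigenvector is lifted back to
  a polynomial.\<close>

lemma invariant_eigenvalue:
  assumes U: "invariant U" "\<not> U \<subseteq> K" and m: "mono_degree m = 1"
  obtains x u where "u \<in> U" "u \<notin> K" "zmonom m * u - pconst x * u \<in> K"
proof -
  have sub: "subsp U" using U by (simp add: invariant_def)
  then have UP: "U \<subseteq> P" by (auto simp: subsp_def intro: poly_space_n_subset)
  obtain s e where on: "orthonormal U s e" and basis: "\<And>f. f \<in> U \<Longrightarrow> f - proj s e f \<in> K"
    using obtain_orthonormal_basis[OF sub] by blast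
  have eU: "e i \<in> U" if "i < s" for i using on that by (simp add: orthonormal_def)
  \<comment> \<open>For \<open>s = 0\<close> every projection is zero, and the basis property would
    put all of \<open>U\<close> into \<open>K\<close>.\<close>
  have "s \<noteq> 0" using basis U(2) by (auto simp: proj_def)
  define A where "A = Matrix.mat s s (\<lambda>(i, j). ip (zmonom m * e j) (e i))"
  have A: "A \<in> carrier_mat s s" by (simp add: A_def)
  obtain x where "eigenvalue A x"
    using spectrum_non_empty[OF A] \<open>s \<noteq> 0\<close> by (auto simp: spectrum_def)
  then obtain v where v: "v \<in> carrier_vec s" "v \<noteq> 0\<^sub>v s" "A *\<^sub>v v = x \<cdot>\<^sub>v v"
    using A by (auto simp: eigenvalue_def eigenvector_def)
  have Av: "(\<Sum>j<s. vec_index v j * ip (zmonom m * e j) (e i)) = x * vec_index v i" if "i < s" for i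
  proof -
    have "vec_index (A *\<^sub>v v) i = (\<Sum>j<s. vec_index v j * ip (zmonom m * e j) (e i))"
      using that v(1) by (simp add: A_def scalar_prod_def atLeast0LessThan mult.commute)
    then show ?thesis using v that by simp
  qed
  define u where "u = (\<Sum>j<s. pconst (vec_index v j) * e j)"
  have uU: "u \<in> U" unfolding u_def
    using sub eU by (intro subsp_sum[OF sub]) (simp add: subsp_def)
  have "u \<notin> K"
  proof
    assume "u \<in> K"
    then have "vec_index v k = 0" if "k < s" for k
      using orthonormal_ip_sum[OF on that, of "vec_index v"] null_polysD[of u "Suc n" \<gamma> "e k"]
        eU[OF that] UP by (auto simp: u_def)
    then have "v = 0\<^sub>v s" using v(1) by (intro eq_vecI) auto
    with v(2) show False by simp
  qed
  have res: "zmonom m * e j - proj s e (zmonom m * e j) \<in> K" if j: "j < s" for j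
  proof -
    obtain w where "w \<in> U" "zmonom m * e j - w \<in> K"
      by (rule invariantE[OF U(1) eU[OF j] m])
    then show ?thesis using residual_null[OF on UP basis] by blast
  qed
  \<comment> \<open>The projected products add up to \<open>pconst x * u\<close> by the eigenvector
    equation, so only a combination of null residuals remains.\<close>
  have "(\<Sum>j<s. pconst (vec_index v j) * proj s e (zmonom m * e j)) =
      (\<Sum>i<s. pconst (\<Sum>j<s. vec_index v j * ip (zmonom m * e j) (e i)) * e i)"
    unfolding proj_def sum_distrib_left sum_distrib_right pconst_sum pconst_mult
    by (subst sum.swap) (simp add: mult.assoc)
  also have "\<dots> = pconst x * u"
    unfolding u_def sum_distrib_left by (intro sum.cong) (auto simp: Av pconst_mult mult.assoc)
  finally have "zmonom m * u - pconst x * u =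
      (\<Sum>j<s. pconst (vec_index v j) * (zmonom m * e j - proj s e (zmonom m * e j)))"
    by (simp add: u_def right_diff_distrib sum_subtractf sum_distrib_left mult.left_commute)
  also have "\<dots> \<in> K" using res by (intro null_polys_sum null_polys_pconst_mult) auto
  finally show thesis by (rule that[OF uU \<open>u \<notin> K\<close>])
qed

text \<open>Multiplication operators commute modulo the null space: both orders are represented by
  \<open>\<langle>z\<^sub>m z\<^sub>k u, g\<rangle>\<close>, in which one factor is moved to the other side to stay in degree \<open>n + 1\<close>.\<close>

lemma invariant_eigenspace:
  assumes U: "invariant U" and m: "mono_degree m = 1"
  shows "invariant {u \<in> U. zmonom m * u - pconst x * u \<in> K}"
proof -
  let ?W = "{u \<in> U. zmonom m * u - pconst x * u \<in> K}"
  have sub: "subsp U" using U by (simp add: invariant_def)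
  have Un: "u \<in> poly_space n" if "u \<in> U" for u using sub that by (auto simp: subsp_def)
  have "subsp ?W"
    unfolding subsp_def
  proof (intro conjI ballI allI)
    show "?W \<subseteq> poly_space n" using Un by auto
    show "0 \<in> ?W" using sub by (simp add: subsp_def)
  next
    fix f g assume f: "f \<in> ?W" and g: "g \<in> ?W"
    have "zmonom m * (f + g) - pconst x * (f + g) =
        (zmonom m * f - pconst x * f) + (zmonom m * g - pconst x * g)"
      by (simp add: algebra_simps)
    then show "f + g \<in> ?W" using f g sub by (simp add: subsp_def null_polys_add)
  next
    fix f c assume f: "f \<in> ?W"
    have "zmonom m * (pconst c * f) - pconst x * (pconst c * f) =
        pconst c * (zmonom m * f - pconst x * f)"
      by (simp add: algebra_simps)
    then show "pconst c * f \<in> ?W" using f sub by (simp add: subsp_def null_polys_pconst_mult)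
  qed
  moreover have "\<exists>v\<in>?W. zmonom k * u - v \<in> K" if u: "u \<in> ?W" and k: "mono_degree k = 1" for u k
  proof -
    obtain v where v: "v \<in> U" "zmonom k * u - v \<in> K"
      using invariantE[OF U _ k] u by blast
    have "zmonom m * v - pconst x * v \<in> K"
    proof (rule nullI)
      show "zmonom m * v - pconst x * v \<in> P"
        using v(1) m by (intro poly_space_diff poly_space_zmonom_mult poly_space_pconst_mult
            poly_space_n_subset Un)
      fix g :: "'d zpoly" assume g: "g \<in> poly_space n"
      have P1: "zmonom (prod.swap m) * g \<in> P" "zmonom (prod.swap k) * g \<in> P" "g \<in> P"
        using g m k by (auto intro: poly_space_zmonom_mult poly_space_n_subset)
      have kv: "ip (zmonom k * u) h = ip v h" if "h \<in> P" for h
        using null_polysD[OF v(2) that] by (simp add: moment_form_diff_left)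
      have mu: "ip (zmonom m * u) h = x * ip u h" if "h \<in> P" for h
        using u null_polysD[of "zmonom m * u - pconst x * u" "Suc n" \<gamma> h] that
        by (simp add: moment_form_diff_left moment_form_pconst_left)
      have "ip (zmonom m * v) g = ip v (zmonom (prod.swap m) * g)"
        by (rule moment_form_zmonom_left)
      also have "\<dots> = ip (zmonom k * u) (zmonom (prod.swap m) * g)"
        using kv P1 by simp
      also have "\<dots> = ip (zmonom m * u) (zmonom (prod.swap k) * g)"
        by (simp add: moment_form_zmonom_left[of _ _ "_ * _"] moment_form_zmonom_left[of _ _ u]
            mult.left_commute)
      also have "\<dots> = x * ip (zmonom k * u) g"
        using mu P1 by (simp add: moment_form_zmonom_left)
      also have "\<dots> = x * ip v g" using kv P1 by simp
      finally show "ip (zmonom m * v - pconst x * v) g = 0"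
        by (simp add: moment_form_diff_left moment_form_pconst_left)
    qed
    with v show ?thesis by blast
  qed
  ultimately show ?thesis by (simp add: invariant_def)
qed

text \<open>Induction over the operators: commutation makes an eigenspace inside \<open>W\<close>
  invariant again, so the next operator still acts on it. Eigenvalue relations found earlier survive
  shrinking \<open>W\<close>.\<close>

lemma joint_eigenspace:
  assumes "finite S" "\<And>m. m \<in> S \<Longrightarrow> mono_degree m = 1" and U: "invariant U" "\<not> U \<subseteq> K"
  shows "\<exists>W\<subseteq>U. invariant W \<and> \<not> W \<subseteq> K \<and>
    (\<forall>m\<in>S. \<exists>x. \<forall>u\<in>W. zmonom m * u - pconst x * u \<in> K)"
  using assms(1,2)
proof (induction S rule: finite_induct)
  case empty
  then show ?case using U by auto
next
  case (insert m S)
  then obtain W where W: "W \<subseteq> U" "invariant W" "\<not> W \<subseteq> K"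
    "\<forall>m\<in>S. \<exists>x. \<forall>u\<in>W. zmonom m * u - pconst x * u \<in> K"
    by auto
  have m: "mono_degree m = 1" using insert.prems by simp
  obtain x u where u: "u \<in> W" "u \<notin> K" "zmonom m * u - pconst x * u \<in> K"
    by (rule invariant_eigenvalue[OF W(2,3) m])
  let ?W = "{u \<in> W. zmonom m * u - pconst x * u \<in> K}"
  have "invariant ?W" by (rule invariant_eigenspace[OF W(2) m])
  moreover have "\<not> ?W \<subseteq> K" using u by blast
  moreover have "\<exists>x. \<forall>u\<in>?W. zmonom k * u - pconst x * u \<in> K" if "k \<in> insert m S" for k
    using that W(4) by (cases "k = m") blast+
  moreover have "?W \<subseteq> U" using W(1) by auto
  ultimately show ?case by blast
qed

text \<open>Variables and conjugate variables receive separate eigenvalues; that these are complex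
  conjugates of each other is derived only in \<open>ip_eigen_eval\<close>.\<close>

definition eigen :: "('d mono \<Rightarrow> complex) \<Rightarrow> 'd zpoly \<Rightarrow> bool" where
  "eigen x u \<longleftrightarrow> (\<forall>m. mono_degree m = 1 \<longrightarrow> zmonom m * u - pconst (x m) * u \<in> K)"

lemma eigenD: "eigen x u \<Longrightarrow> mono_degree m = 1 \<Longrightarrow> zmonom m * u - pconst (x m) * u \<in> K"
  unfolding eigen_def by blast

lemma joint_eigenvector:
  assumes "invariant U" "\<not> U \<subseteq> K"
  obtains x u where "u \<in> U" "u \<notin> K" "eigen x u"
proof -
  let ?S = "{m :: 'd mono. mono_degree m = 1}"
  have "finite ?S" by (rule finite_subset[OF _ finite_monos[of 1]]) auto
  from joint_eigenspace[OF this _ assms] obtain W where W: "W \<subseteq> U" "\<not> W \<subseteq> K"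
    "\<forall>m\<in>?S. \<exists>x. \<forall>u\<in>W. zmonom m * u - pconst x * u \<in> K"
    by auto
  then obtain u where u: "u \<in> W" "u \<notin> K" by blast
  from bchoice[OF W(3)] obtain x where "\<forall>m\<in>?S. \<forall>u\<in>W. zmonom m * u - pconst (x m) * u \<in> K" by blast
  with u have "eigen x u" unfolding eigen_def by blast
  with u W(1) show thesis using that by blast
qed

lemma eigen_pconst_mult: "eigen x u \<Longrightarrow> eigen x (pconst c * u)"
  unfolding eigen_def
proof (intro allI impI)
  fix m :: "'d mono"
  assume "\<forall>m. mono_degree m = 1 \<longrightarrow> zmonom m * u - pconst (x m) * u \<in> K" "mono_degree m = 1"
  then have "pconst c * (zmonom m * u - pconst (x m) * u) \<in> K"
    by (blast intro: null_polys_pconst_mult)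
  then show "zmonom m * (pconst c * u) - pconst (x m) * (pconst c * u) \<in> K"
    by (simp add: right_diff_distrib mult.left_commute)
qed

text \<open>Moving the monomial across the form lets its conjugate act on \<open>u\<close>; the
  eigenvalue comes out of the second argument and is therefore conjugated.\<close>

lemma ip_eigen:
  assumes "eigen x u" "mono_degree m = 1" "q \<in> P"
  shows "ip (zmonom m * q) u = cnj (x (prod.swap m)) * ip q u"
proof -
  have "zmonom (prod.swap m) * u - pconst (x (prod.swap m)) * u \<in> K"
    using assms by (intro eigenD) simp_all
  from null_right[OF this assms(3)] show ?thesis
    by (simp add: moment_form_zmonom_left moment_form_diff_right moment_form_pconst_right)
qed

text \<open>The family of operators is closed under adjoints, so the orthogonal complement of joint
  eigenvectors is invariant. This is the spectral theorem's induction step.\<close>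

lemma invariant_orthogonal:
  assumes e: "\<And>i. i < s \<Longrightarrow> eigen (x i) (e i)" "\<And>i. i < s \<Longrightarrow> e i \<in> P"
  shows "invariant {f \<in> poly_space n. \<forall>i<s. ip f (e i) = 0}"
proof -
  let ?R = "{f \<in> poly_space n. \<forall>i<s. ip f (e i) = 0}"
  have "subsp ?R"
    by (auto simp: subsp_def poly_space_add poly_space_pconst_mult moment_form_add_left
        moment_form_pconst_left)
  moreover have "\<exists>v\<in>?R. zmonom m * u - v \<in> K" if u: "u \<in> ?R" and m: "mono_degree m = 1" for u m
  proof -
    have uP: "u \<in> P" using u poly_space_n_subset by simp
    have "zmonom m * u \<in> P" using u m poly_space_zmonom_mult by blast
    then obtain g where g: "g \<in> poly_space n" "zmonom m * u - g \<in> K" by (rule reduce)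
    have "ip g (e i) = 0" if "i < s" for i
      using null_polysD[OF g(2) e(2)[OF that]] ip_eigen[OF e(1)[OF that] m uP] u that
      by (simp add: moment_form_diff_left)
    with g show ?thesis by blast
  qed
  ultimately show ?thesis by (simp add: invariant_def)
qed

text \<open>A longest orthonormal family of joint eigenvectors is taken. If its complement were not
  null, it would contain a further joint eigenvector, and the family could be extended.\<close>

lemma obtain_eigenbasis:
  obtains e x where "orthonormal (poly_space n) r e" "\<And>i. i < r \<Longrightarrow> eigen (x i) (e i)"
    "\<And>f. f \<in> P \<Longrightarrow> f - proj r e f \<in> K"
proof -
  let ?Q = "\<lambda>s. \<exists>e x. orthonormal (poly_space n) s e \<and> (\<forall>i<s. eigen (x i) (e i))"
  have nP: "poly_space n \<subseteq> P" using poly_space_n_subset by blast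
  have "?Q 0" by (simp add: orthonormal_def)
  moreover have "\<forall>s. ?Q s \<longrightarrow> s \<le> r" using orthonormal_length_le_r by blast
  ultimately have "\<exists>s. ?Q s \<and> (\<forall>s'. ?Q s' \<longrightarrow> s' \<le> s)"
    by (rule Nat.ex_has_greatest_nat)
  then obtain s where Qs: "?Q s" and max: "\<forall>s'. ?Q s' \<longrightarrow> s' \<le> s"
    by (rule exE) (erule conjE, rule that)
  have s: "\<And>s'. ?Q s' \<Longrightarrow> s' \<le> s" using max by blast
  from Qs obtain e x where on: "orthonormal (poly_space n) s e" and ex: "\<And>i. i < s \<Longrightarrow> eigen (x i) (e i)"
    by blast
  have eP: "e i \<in> P" if "i < s" for i using on that nP by (auto simp: orthonormal_def)
  let ?R = "{f \<in> poly_space n. \<forall>i<s. ip f (e i) = 0}"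
  have R: "?R \<subseteq> K"
  proof (rule ccontr)
    assume "\<not> ?R \<subseteq> K"
    with invariant_orthogonal[of s x e, OF ex eP] obtain y u
      where u: "u \<in> ?R" "u \<notin> K" "eigen y u"
      by (rule joint_eigenvector)
    have "pconst c * u \<in> poly_space n" for c using u by (simp add: poly_space_pconst_mult)
    then obtain c where c: "orthonormal (poly_space n) (Suc s) (e(s := pconst c * u))"
      using orthonormal_extend[OF on nP, of u] u poly_space_n_subset by blast
    have "\<forall>i<Suc s. eigen ((x(s := y)) i) ((e(s := pconst c * u)) i)"
      using ex eigen_pconst_mult[OF u(3)] by (simp add: less_Suc_eq)
    with c have "Suc s \<le> s" by (intro s exI conjI)
    then show False by simp
  qed
  have basis_n: "f - proj s e f \<in> K" if "f \<in> poly_space n" for f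
  proof -
    have "f - proj s e f \<in> poly_space n"
      using that proj_mem[OF subsp_poly_space on] by (rule poly_space_diff)
    then show ?thesis using ip_residual[OF on] R by blast
  qed
  have basis: "f - proj s e f \<in> K" if f: "f \<in> P" for f
  proof -
    obtain g where "g \<in> poly_space n" "f - g \<in> K" using f by (rule reduce)
    then show ?thesis using residual_null[OF on nP basis_n] by blast
  qed
  have "s = r"
  proof (rule antisym)
    show "s \<le> r" using orthonormal_length_le_r[OF on] by simp
    show "r \<le> s"
    proof (rule ccontr)
      assume "\<not> r \<le> s"
      then have "s < r" by simp
      \<comment> \<open>With \<open>s < r\<close> some nontrivial combination of the
        \<open>b i\<close> is orthogonal to every \<open>e k\<close>. Its projection is then zero,
        so it is null, against the independence of the \<open>b i\<close>.\<close>
      from exists_nontrivial_relation[OF this, of "\<lambda>i k. ip (b i) (e k)"] obtain c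
        where c: "\<exists>i<r. c i \<noteq> 0" "\<And>k. k < s \<Longrightarrow> (\<Sum>i<r. c i * ip (b i) (e k)) = 0"
        by blast
      let ?f = "\<Sum>i<r. pconst (c i) * b i"
      have "?f \<in> P" by (intro poly_space_sum poly_space_pconst_mult poly_space_n_subset basis_mem) simp
      moreover have "proj s e ?f = 0"
        by (simp add: proj_def moment_form_sum_left moment_form_pconst_left c(2))
      ultimately have "?f \<in> K" using basis[of ?f] by simp
      then have "\<forall>i<r. c i = 0" using basis_indep[of c] by blast
      then show False using c(1) by blast
    qed
  qed
  with on ex basis show thesis using that by blast
qed

text \<open>The functional \<open>\<lambda>f. ip f (e i)\<close> picks up an eigenvalue for each
  variable pulled out of a monomial, hence it is evaluation at the point of eigenvalues, scaled by
  its value at 1.\<close>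

lemma ip_eigen_eval:
  assumes on: "orthonormal (poly_space n) r e" and ex: "\<And>i. i < r \<Longrightarrow> eigen (x i) (e i)"
    and i: "i < r" and f: "f \<in> P"
  shows "ip f (e i) = poly_eval f (\<chi> k. x i (0, axis k (Suc 0))) * ip 1 (e i)"
proof -
  let ?w = "\<chi> k. x i (0, axis k (Suc 0))"
  have eiP: "e i \<in> P" using on i by (simp add: orthonormal_def poly_space_n_subset)
  have ei: "ip (e i) (e i) = 1" using on i by (simp add: orthonormal_def)
  \<comment> \<open>\<open>ip (zmonom m * e i) (e i)\<close> is computed twice: through the
    eigenvalue of \<open>m\<close>, and through that of its adjoint.\<close>
  have conj: "x i m = cnj (x i (prod.swap m))" if m: "mono_degree m = 1" for m
  proof -
    have "zmonom m * e i - pconst (x i m) * e i \<in> K" by (rule eigenD[OF ex[OF i] m])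
    from null_polysD[OF this eiP] have "ip (zmonom m * e i) (e i) = x i m"
      by (simp add: moment_form_diff_left moment_form_pconst_left ei)
    then show ?thesis using ip_eigen[OF ex[OF i] m eiP] ei by simp
  qed
  \<comment> \<open>The point is built from the eigenvalues of the unconjugated variables. For a
    conjugate variable the claim is immediate; for a variable it needs \<open>conj\<close>.\<close>
  have deg1: "cnj (x i (prod.swap m)) = mono_eval m ?w" if m: "mono_degree m = 1" for m
    using m
  proof (rule mono_degree_oneE)
    fix k assume "m = (0, axis k (Suc 0))"
    then show ?thesis using conj[OF m] by simp
  next
    fix k assume "m = (axis k (Suc 0), 0)"
    then show ?thesis by simp
  qed
  have mono: "ip (zmonom m) (e i) = mono_eval m ?w * ip 1 (e i)" if "mono_degree m = d" "d \<le> Suc n" for m d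
    using that
  proof (induction d arbitrary: m)
    case 0
    then show ?case by (simp add: mono_degree_eq_0 zmonom_def)
  next
    case (Suc d)
    obtain m1 m2 where m: "m = m1 + m2" "mono_degree m1 = 1" "mono_degree m2 = d"
      using mono_degree_split Suc.prems(1) by blast
    have "zmonom m = zmonom m1 * zmonom m2" by (simp add: m zmonom_def mult_single)
    moreover have "zmonom m2 \<in> P" using m Suc.prems by (intro poly_space_zmonom) simp
    ultimately show ?case
      using ip_eigen[OF ex[OF i] m(2), of "zmonom m2"] deg1[OF m(2)] Suc m
      by (simp add: mono_eval_add)
  qed
  have "ip f (e i) = (\<Sum>m\<in>Poly_Mapping.keys f. Poly_Mapping.lookup f m * ip (zmonom m) (e i))"
    by (subst zpoly_eq_sum_zmonom[of f]) (simp only: moment_form_sum_left moment_form_pconst_left)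
  also have "\<dots> = (\<Sum>m\<in>Poly_Mapping.keys f. Poly_Mapping.lookup f m * (mono_eval m ?w * ip 1 (e i)))"
    using f mono by (intro sum.cong) (auto simp: poly_space_def)
  finally show ?thesis by (simp add: poly_eval_def sum_distrib_right mult.assoc)
qed

theorem obtain_quadrature:
  obtains \<omega> h \<rho> where "quadrature n r \<gamma> \<omega> h \<rho>"
proof -
  obtain e x where on: "orthonormal (poly_space n) r e" and ex: "\<And>i. i < r \<Longrightarrow> eigen (x i) (e i)"
    and basis: "\<And>f. f \<in> P \<Longrightarrow> f - proj r e f \<in> K"
    by (rule obtain_eigenbasis) (rule that, blast+)
  define \<omega> :: "nat \<Rightarrow> complex ^ 'd" where "\<omega> i = (\<chi> k. x i (0, axis k (Suc 0)))" for i
  define c where "c i = ip 1 (e i)" for i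
  have ip_e: "ip f (e i) = poly_eval f (\<omega> i) * c i" if "f \<in> P" "i < r" for f i
    using ip_eigen_eval[OF on ex that(2,1)] by (simp add: \<omega>_def c_def)
  have en: "e i \<in> poly_space n" "e i \<in> P" if "i < r" for i
    using on that by (auto simp: orthonormal_def intro: poly_space_n_subset)
  \<comment> \<open>Orthonormality read through evaluation. It yields both
    \<open>c i \<noteq> 0\<close>, hence positive weights, and the Lagrange property.\<close>
  have delta: "poly_eval (e k) (\<omega> i) * c i = (if i = k then 1 else 0)" if "i < r" "k < r" for i k
    using ip_e[OF en(2) that(1), of k] that on by (auto simp: orthonormal_def)
  have c0: "c i \<noteq> 0" if "i < r" for i using delta[OF that that] by auto
  have "quadrature n r \<gamma> \<omega> (\<lambda>k. pconst (c k) * e k) (\<lambda>k. (cmod (c k))\<^sup>2)"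
  proof (rule quadrature.intro)
    fix k assume k: "k < r"
    show "pconst (c k) * e k \<in> poly_space n" using en k by (simp add: poly_space_pconst_mult)
    show "0 < (cmod (c k))\<^sup>2" using c0[OF k] by simp
    fix i assume i: "i < r"
    show "poly_eval (pconst (c k) * e k) (\<omega> i) = (if i = k then 1 else 0)"
      unfolding poly_eval_pconst_mult using delta[OF i k] c0[OF i]
      by (auto simp: mult.commute split: if_splits)
  next
    fix f g assume f: "f \<in> P" and g: "g \<in> P"
    have "ip f g = ip (proj r e f) g"
      using null_polysD[OF basis[OF f] g] by (simp add: moment_form_diff_left)
    also have "\<dots> = (\<Sum>k<r. ip f (e k) * cnj (ip g (e k)))"
      unfolding proj_def moment_form_sum_left moment_form_pconst_left
      using hermitian[OF g en(2)] by (intro sum.cong) auto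
    also have "\<dots> = (\<Sum>k<r. of_real ((cmod (c k))\<^sup>2) * poly_eval f (\<omega> k) * cnj (poly_eval g (\<omega> k)))"
      unfolding complex_norm_square using f g by (intro sum.cong) (auto simp: ip_e)
    finally show "ip f g = \<dots>" .
  qed
  then show thesis by (rule that)
qed

end

subsection \<open>Nodes and the variety\<close>

context quadrature
begin

definition nodes :: "(complex ^ 'd) set" where "nodes = \<omega> ` {..<r}"

lemma h_mem_Suc: "k < r \<Longrightarrow> h k \<in> poly_space (Suc n)"
  using h_mem by (rule poly_space_mono) auto

lemma form_h: "f \<in> poly_space (Suc n) \<Longrightarrow> k < r \<Longrightarrow> moment_form \<gamma> f (h k) = of_real (\<rho> k) * poly_eval f (\<omega> k)"
proof -
  assume f: "f \<in> poly_space (Suc n)" and k: "k < r"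
  have "moment_form \<gamma> f (h k) = (\<Sum>i<r. if i = k then of_real (\<rho> k) * poly_eval f (\<omega> k) else 0)"
    unfolding form_eq[OF f h_mem_Suc[OF k]] using k by (intro sum.cong) (auto simp: h_eval)
  then show ?thesis using k by simp
qed

text \<open>Pairing with \<open>h k\<close> isolates the value at one node, and the positive weight
  can be divided out. Conversely the form sees only values at nodes.\<close>

lemma null_polys_iff:
  assumes "p \<in> poly_space (Suc n)"
  shows "p \<in> null_polys (Suc n) \<gamma> \<longleftrightarrow> (\<forall>k<r. poly_eval p (\<omega> k) = 0)"
proof
  assume p: "p \<in> null_polys (Suc n) \<gamma>"
  show "\<forall>k<r. poly_eval p (\<omega> k) = 0"
  proof (intro allI impI)
    fix k assume k: "k < r"
    show "poly_eval p (\<omega> k) = 0"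
      using form_h[OF assms k] null_polysD[OF p h_mem_Suc[OF k]] weight_pos[OF k] by simp
  qed
qed (use assms in \<open>simp add: null_polys_def form_eq\<close>)

text \<open>If two nodes coincided, one Lagrange polynomial would take both values 0 and 1
  there.\<close>

lemma inj_nodes: "inj_on \<omega> {..<r}"
proof (rule inj_onI)
  fix i k assume "i \<in> {..<r}" "k \<in> {..<r}" "\<omega> i = \<omega> k"
  then show "i = k" using h_eval[of i k] h_eval[of k k] by (auto split: if_splits)
qed

lemma card_nodes: "finite nodes" "card nodes = r"
  using inj_nodes by (simp_all add: nodes_def card_image)

lemma moment_eq:
  assumes "mono_degree (i, j) \<le> 2 * n + 2"
  shows "\<gamma> i j = (\<Sum>k<r. of_real (\<rho> k) * mono_eval (i, j) (\<omega> k))"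
proof -
  have "mono_degree (i, j) \<le> Suc n + Suc n" using assms by simp
  then obtain m1 m2 where m: "(i, j) = m1 + m2" "mono_degree m1 \<le> Suc n" "mono_degree m2 \<le> Suc n"
    by (rule mono_degree_split2)
  have "moment_form \<gamma> (zmonom m1) (zmonom (prod.swap m2)) = riesz \<gamma> (zmonom (i, j))"
    unfolding m(1) by (simp add: moment_form_def conj_poly_zmonom) (simp add: zmonom_def mult_single)
  moreover have "moment_form \<gamma> (zmonom m1) (zmonom (prod.swap m2)) =
      (\<Sum>k<r. of_real (\<rho> k) * mono_eval m1 (\<omega> k) * cnj (mono_eval (prod.swap m2) (\<omega> k)))"
    using m(2,3) by (simp add: form_eq poly_space_zmonom poly_eval_zmonom)
  moreover have "mono_eval (i, j) z = mono_eval m1 z * mono_eval m2 z" for z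
    unfolding m(1) by (rule mono_eval_add)
  ultimately show ?thesis
    by (simp add: riesz_zmonom mono_eval_swap mult.assoc)
qed

text \<open>Since \<open>h k\<close> vanishes at all nodes but \<open>\<omega> k\<close>, where the coordinates are known, finitely many
  null polynomials of degree at most \<open>n + 1\<close> already cut out the nodes.\<close>

lemma finite_separating_null_polys:
  obtains T where "finite T" "T \<subseteq> null_polys (Suc n) \<gamma>" "(\<Inter>p\<in>T. zero_set p) \<subseteq> nodes"
proof -
  define q where "q k i = (zmonom (0, axis i (Suc 0)) - pconst (\<omega> k $ i)) * h k" for k i
  \<comment> \<open>Where \<open>q0\<close> vanishes the values of the \<open>h k\<close> sum to 1,
    so some \<open>h k\<close> is nonzero there and can be cancelled from
    \<open>q k i\<close>.\<close>
  define q0 where "q0 = 1 - (\<Sum>k<r. h k)"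
  have q0: "q0 \<in> null_polys (Suc n) \<gamma>"
  proof (subst null_polys_iff)
    show "q0 \<in> poly_space (Suc n)"
      unfolding q0_def using h_mem_Suc by (intro poly_space_diff poly_space_sum) auto
    show "\<forall>k<r. poly_eval q0 (\<omega> k) = 0"
      by (simp add: q0_def poly_eval_diff poly_eval_sum h_eval)
  qed
  have q: "q k i \<in> null_polys (Suc n) \<gamma>" if "k < r" for k i
  proof (subst null_polys_iff)
    show "q k i \<in> poly_space (Suc n)"
      unfolding q_def left_diff_distrib using that
      by (intro poly_space_diff poly_space_zmonom_mult poly_space_pconst_mult h_mem_Suc h_mem) auto
    show "\<forall>l<r. poly_eval (q k i) (\<omega> l) = 0"
      using that by (simp add: q_def poly_eval_mult poly_eval_diff poly_eval_zmonom h_eval)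
  qed
  show thesis
  proof (rule that[of "insert q0 (case_prod q ` ({..<r} \<times> UNIV))"])
    show "(\<Inter>p\<in>insert q0 (case_prod q ` ({..<r} \<times> UNIV)). zero_set p) \<subseteq> nodes"
    proof
      fix z assume z: "z \<in> (\<Inter>p\<in>insert q0 (case_prod q ` ({..<r} \<times> UNIV)). zero_set p)"
      then have "(\<Sum>k<r. poly_eval (h k) z) = 1"
        by (simp add: zero_set_def q0_def poly_eval_diff poly_eval_sum)
      then have "(\<Sum>k<r. poly_eval (h k) z) \<noteq> 0" by simp
      then obtain k where k: "k < r" "poly_eval (h k) z \<noteq> 0"
        by (auto elim: sum.not_neutral_contains_not_neutral)
      have "z $ i = \<omega> k $ i" for i
      proof -
        have "poly_eval (q k i) z = 0" using z k(1) by (auto simp: zero_set_def)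
        then show ?thesis using k(2) by (simp add: q_def poly_eval_mult poly_eval_diff poly_eval_zmonom)
      qed
      then have "z = \<omega> k" by (simp add: Finite_Cartesian_Product.vec_eq_iff)
      then show "z \<in> nodes" using k(1) by (simp add: nodes_def)
    qed
  qed (use q0 q in auto)
qed

lemma zero_sets_null_polys: "(\<Inter>p\<in>null_polys (Suc n) \<gamma>. zero_set p) = nodes"
proof
  show "(\<Inter>p\<in>null_polys (Suc n) \<gamma>. zero_set p) \<subseteq> nodes"
  proof -
    obtain T where "T \<subseteq> null_polys (Suc n) \<gamma>" "(\<Inter>p\<in>T. zero_set p) \<subseteq> nodes"
      by (rule finite_separating_null_polys)
    then show ?thesis by blast
  qed
  show "nodes \<subseteq> (\<Inter>p\<in>null_polys (Suc n) \<gamma>. zero_set p)"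
  proof (intro INT_greatest subsetI)
    fix p z assume p: "p \<in> null_polys (Suc n) \<gamma>" and z: "z \<in> nodes"
    then show "z \<in> zero_set p"
      using null_polys_iff[OF null_polys_in_space[OF p]] by (auto simp: nodes_def zero_set_def)
  qed
qed

subsection \<open>Representing measures\<close>

text \<open>The atomic measure as an image of a weighted measure on indices, which turns integrals
  into finite sums.\<close>

definition quadrature_measure :: "(complex ^ 'd) measure" where
  "quadrature_measure = distr (point_measure {..<r} (\<lambda>k. ennreal (\<rho> k))) borel \<omega>"

lemma sets_quadrature_measure: "sets quadrature_measure = sets borel"
  by (simp add: quadrature_measure_def)

lemma emeasure_quadrature_measure:
  assumes "A \<in> sets borel"
  shows "emeasure quadrature_measure A = (\<Sum>k<r. ennreal (\<rho> k) * indicator A (\<omega> k))"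
proof -
  have "emeasure quadrature_measure A = emeasure (point_measure {..<r} (\<lambda>k. ennreal (\<rho> k))) (\<omega> -` A \<inter> {..<r})"
    unfolding quadrature_measure_def using assms
    by (subst emeasure_distr) (auto simp: measurable_point_measure_eq1 space_point_measure)
  also have "\<dots> = (\<Sum>k\<in>\<omega> -` A \<inter> {..<r}. ennreal (\<rho> k))"
    by (subst emeasure_point_measure_finite) auto
  also have "\<dots> = (\<Sum>k<r. ennreal (\<rho> k) * indicator A (\<omega> k))"
    by (intro sum.mono_neutral_cong_left) (auto simp: indicator_def)
  finally show ?thesis .
qed

end

lemma borel_measurable_mono_eval [measurable]: "mono_eval m \<in> borel_measurable borel"
proof (rule borel_measurable_continuous_onI)
  show "continuous_on UNIV (mono_eval m)"
    unfolding mono_eval_def by (intro continuous_intros)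
qed

lemma representing_measure_integrable_poly:
  assumes \<nu>: "representing_measure l \<gamma> \<nu>" and p: "p \<in> poly_space l"
  shows "integrable \<nu> (poly_eval p)" "(LINT z|\<nu>. poly_eval p z) = riesz \<gamma> p"
proof -
  have int: "integrable \<nu> (mono_eval m)" "\<gamma> (fst m) (snd m) = (LINT z|\<nu>. mono_eval m z)"
    if "m \<in> Poly_Mapping.keys p" for m
    using \<nu> p that by (cases m, auto simp: representing_measure_def poly_space_def)+
  have eq: "poly_eval p = (\<lambda>z. \<Sum>m\<in>Poly_Mapping.keys p. Poly_Mapping.lookup p m * mono_eval m z)"
    by (simp add: poly_eval_def fun_eq_iff)
  show "integrable \<nu> (poly_eval p)"
    unfolding eq using int by (intro Bochner_Integration.integrable_sum integrable_mult_right)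
  show "(LINT z|\<nu>. poly_eval p z) = riesz \<gamma> p"
    unfolding eq riesz_def using int by (subst Bochner_Integration.integral_sum) auto
qed

text \<open>The integral of \<open>|p|\<^sup>2\<close> is \<open>moment_form \<gamma> p p\<close>,
  which is zero; a nonnegative function with zero integral vanishes almost everywhere.\<close>

lemma representing_measure_null_AE:
  assumes \<nu>: "representing_measure (2 * l) \<gamma> \<nu>" and p: "p \<in> null_polys l \<gamma>"
  shows "AE z in \<nu>. poly_eval p z = 0"
proof -
  have pl: "p \<in> poly_space l" using p by (rule null_polys_in_space)
  have cl: "conj_poly p \<in> poly_space l"
    using pl by (intro poly_spaceI) (simp add: lookup_conj_poly poly_spaceD)
  have mem: "p * conj_poly p \<in> poly_space (2 * l)"
    using poly_space_mult[OF pl cl] by (simp add: mult_2)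
  have eq: "poly_eval (p * conj_poly p) z = of_real ((cmod (poly_eval p z))\<^sup>2)" for z
    unfolding complex_norm_square by (simp add: poly_eval_mult poly_eval_conj)
  have int: "integrable \<nu> (\<lambda>z. complex_of_real ((cmod (poly_eval p z))\<^sup>2))"
    using representing_measure_integrable_poly(1)[OF \<nu> mem] unfolding eq[abs_def] .
  then have int': "integrable \<nu> (\<lambda>z. (cmod (poly_eval p z))\<^sup>2)"
    using integrable_Re[OF int] by simp
  have "complex_of_real (LINT z|\<nu>. (cmod (poly_eval p z))\<^sup>2) = moment_form \<gamma> p p"
    using representing_measure_integrable_poly(2)[OF \<nu> mem]
    unfolding eq moment_form_def integral_complex_of_real .
  also have "\<dots> = 0" using null_polysD[OF p pl] .
  finally have "(LINT z|\<nu>. (cmod (poly_eval p z))\<^sup>2) = 0" by simp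
  then show ?thesis using integral_nonneg_eq_0_iff_AE[OF int'] by simp
qed

context quadrature
begin

lemma representing_quadrature_measure: "representing_measure (2 * n + 2) \<gamma> quadrature_measure"
  unfolding representing_measure_def
proof (intro conjI allI impI)
  fix i j :: "nat ^ 'd" assume deg: "mono_degree (i, j) \<le> 2 * n + 2"
  have meas: "\<omega> \<in> measurable (point_measure {..<r} (\<lambda>k. ennreal (\<rho> k))) borel"
    by (simp add: measurable_point_measure_eq1)
  show "integrable quadrature_measure (mono_eval (i, j))"
    unfolding quadrature_measure_def
    by (subst integrable_distr_eq[OF meas]) (auto intro: integrable_point_measure_finite)
  have "(LINT z|quadrature_measure. mono_eval (i, j) z) = (\<Sum>k<r. \<rho> k *\<^sub>R mono_eval (i, j) (\<omega> k))"
    unfolding quadrature_measure_def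
    by (subst integral_distr[OF meas], simp,
        subst lebesgue_integral_point_measure_finite) (auto intro: less_imp_le weight_pos)
  then show "\<gamma> i j = (LINT z|quadrature_measure. mono_eval (i, j) z)"
    using moment_eq[OF deg] by (simp add: scaleR_conv_of_real)
qed (rule sets_quadrature_measure)

lemma representing_measure_unique:
  assumes \<nu>: "representing_measure (2 * n + 2) \<gamma> \<nu>"
  shows "\<nu> = quadrature_measure"
proof (rule measure_eqI)
  have sets [measurable_cong, simp]: "sets \<nu> = sets borel" using \<nu> by (simp add: representing_measure_def)
  then have space [simp]: "space \<nu> = UNIV" using sets_eq_imp_space_eq by fastforce
  show "sets \<nu> = sets quadrature_measure" by (simp add: sets_quadrature_measure)
  have \<nu>': "representing_measure (2 * Suc n) \<gamma> \<nu>" using \<nu> by simp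
  obtain T where T: "finite T" "T \<subseteq> null_polys (Suc n) \<gamma>" "(\<Inter>p\<in>T. zero_set p) \<subseteq> nodes"
    by (rule finite_separating_null_polys)
  \<comment> \<open>The finiteness of \<open>T\<close> allows the exceptional null sets to be
    united.\<close>
  have "AE z in \<nu>. \<forall>p\<in>T. poly_eval p z = 0"
    using T(1,2) representing_measure_null_AE[OF \<nu>'] by (intro AE_finite_allI) auto
  then have nodes: "AE z in \<nu>. z \<in> nodes"
    by (rule eventually_mono) (use T(3) in \<open>auto simp: zero_set_def\<close>)
  \<comment> \<open>The moment of degree zero is the total mass, so the measure is finite and
    real-valued masses determine \<open>emeasure\<close>.\<close>
  have "integrable \<nu> (poly_eval 1)"
    using \<nu> by (rule representing_measure_integrable_poly) simp
  moreover have "poly_eval (1 :: 'd zpoly) = (\<lambda>z. 1)" by (simp add: fun_eq_iff)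
  ultimately have "integrable \<nu> (\<lambda>z. 1 :: complex)" by simp
  then interpret finite_measure \<nu>
    by (intro finite_measureI) (simp add: integrable_iff_bounded less_top[symmetric])
  have atom: "emeasure \<nu> {\<omega> k} = ennreal (\<rho> k)" if k: "k < r" for k
  proof -
    have "(LINT z|\<nu>. poly_eval (h k) z) = riesz \<gamma> (h k)"
      using \<nu> poly_space_mono[OF h_mem[OF k], of "2 * n + 2"]
      by (intro representing_measure_integrable_poly(2)) auto
    also have "\<dots> = moment_form \<gamma> (h k) 1"
      by (simp add: moment_form_def)
    also have "\<dots> = (\<Sum>i<r. if i = k then of_real (\<rho> k) else 0)"
      unfolding form_eq[OF h_mem_Suc[OF k] poly_space_one] using k by (intro sum.cong) (auto simp: h_eval)
    also have "\<dots> = of_real (\<rho> k)" using k by simp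
    finally have "(LINT z|\<nu>. poly_eval (h k) z) = of_real (\<rho> k)" .
    \<comment> \<open>On the nodes, hence almost everywhere, the Lagrange polynomial is the
      indicator of its node.\<close>
    moreover have "(LINT z|\<nu>. poly_eval (h k) z) = (LINT z|\<nu>. complex_of_real (indicator {\<omega> k} z))"
    proof (rule integral_cong_AE)
      show "poly_eval (h k) \<in> borel_measurable \<nu>"
        by (simp add: poly_eval_def[abs_def])
      show "AE z in \<nu>. poly_eval (h k) z = complex_of_real (indicator {\<omega> k} z)"
        using nodes
      proof (rule eventually_mono)
        fix z assume "z \<in> nodes"
        then obtain i where i: "i < r" "z = \<omega> i" by (auto simp: nodes_def)
        then show "poly_eval (h k) z = complex_of_real (indicator {\<omega> k} z)"
          using k inj_nodes by (auto simp: h_eval inj_on_def indicator_def)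
      qed
    qed simp
    moreover have "(LINT z|\<nu>. complex_of_real (indicator {\<omega> k} z)) = of_real (measure \<nu> {\<omega> k})"
      by simp
    ultimately have "measure \<nu> {\<omega> k} = \<rho> k" by (metis of_real_eq_iff)
    then show ?thesis by (simp add: emeasure_eq_measure)
  qed
  fix A assume "A \<in> sets \<nu>"
  then have A: "A \<in> sets borel" by simp
  have "emeasure \<nu> A = emeasure \<nu> (A \<inter> nodes)"
  proof (rule emeasure_eq_AE)
    show "AE z in \<nu>. z \<in> A \<longleftrightarrow> z \<in> A \<inter> nodes"
      using nodes by (rule eventually_mono) auto
    have "nodes \<in> sets borel" using card_nodes(1) by (intro borel_closed finite_imp_closed)
    then show "A \<inter> nodes \<in> sets \<nu>" using A by simp
  qed (use A in simp)
  also have "\<dots> = (\<Sum>x\<in>A \<inter> nodes. emeasure \<nu> {x})"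
    using card_nodes(1) by (intro emeasure_eq_sum_singleton) auto
  also have "\<dots> = (\<Sum>x\<in>nodes. emeasure \<nu> {x} * indicator A x)"
    using card_nodes(1) by (intro sum.mono_neutral_cong_left) (auto simp: indicator_def)
  also have "\<dots> = (\<Sum>k<r. ennreal (\<rho> k) * indicator A (\<omega> k))"
    unfolding nodes_def by (subst sum.reindex[OF inj_nodes]) (simp add: atom)
  finally show "emeasure \<nu> A = emeasure quadrature_measure A"
    by (simp add: emeasure_quadrature_measure[OF A])
qed

text \<open>Finiteness makes the complement of the nodes open, and it carries no mass; each node
  carries positive mass.\<close>

lemma support_quadrature_measure: "measure_support quadrature_measure = nodes"
proof
  show "measure_support quadrature_measure \<subseteq> nodes"
  proof
    fix x assume x: "x \<in> measure_support quadrature_measure"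
    show "x \<in> nodes"
    proof (rule ccontr)
      assume "x \<notin> nodes"
      moreover have o: "open (- nodes)" using card_nodes(1) by (simp add: finite_imp_closed open_Compl)
      ultimately have "emeasure quadrature_measure (- nodes) > 0"
        using x by (simp add: measure_support_def)
      then show False using o by (simp add: emeasure_quadrature_measure nodes_def)
    qed
  qed
  show "nodes \<subseteq> measure_support quadrature_measure"
    unfolding measure_support_def
  proof (intro subsetI CollectI allI impI)
    fix x U assume "x \<in> nodes" and U: "open U \<and> x \<in> U"
    then obtain k where k: "k < r" "\<omega> k \<in> U" by (auto simp: nodes_def)
    have "0 < ennreal (\<rho> k) * indicator U (\<omega> k)" using k weight_pos by simp
    also have "\<dots> \<le> (\<Sum>k<r. ennreal (\<rho> k) * indicator U (\<omega> k))"
      using k by (intro member_le_sum) auto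
    finally show "emeasure quadrature_measure U > 0"
      using U by (simp add: emeasure_quadrature_measure)
  qed
qed

end

section \<open>The moment matrix in terms of its form\<close>

lemma psd_moment_form:
  fixes \<gamma> :: "nat ^ 'd::finite \<Rightarrow> nat ^ 'd \<Rightarrow> complex"
  assumes "psd_mat (moment_matrix l \<gamma>)" "f \<in> poly_space l"
  shows "moment_form \<gamma> f f \<in> \<real>" "0 \<le> Re (moment_form \<gamma> f f)"
proof -
  have "coeff_vec l f \<in> carrier_vec (dim_row (moment_matrix l \<gamma>))"
    using moment_matrix_carrier[of l \<gamma>] by (auto simp: coeff_vec_def)
  then show "moment_form \<gamma> f f \<in> \<real>" "0 \<le> Re (moment_form \<gamma> f f)"
    using assms by (auto simp: psd_mat_def moment_form_def moment_matrix_inner[symmetric])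
qed

text \<open>\<open>psd_mat\<close> speaks only of the quadratic form; symmetry follows by
  polarisation from its being real on \<open>f + pconst c * g\<close>.\<close>

lemma psd_moment_form_hermitian:
  assumes psd: "psd_mat (moment_matrix l \<gamma>)" and f: "f \<in> poly_space l" and g: "g \<in> poly_space l"
  shows "moment_form \<gamma> g f = cnj (moment_form \<gamma> f g)"
proof -
  have im: "Im (moment_form \<gamma> p p) = 0" if "p \<in> poly_space l" for p
    using psd_moment_form(1)[OF psd that] by (simp add: complex_is_Real_iff)
  have "Im (cnj c * moment_form \<gamma> f g + c * moment_form \<gamma> g f) = 0" for c
  proof -
    have "f + pconst c * g \<in> poly_space l" using f g by (simp add: poly_space_add poly_space_pconst_mult)
    moreover have "moment_form \<gamma> (f + pconst c * g) (f + pconst c * g) = moment_form \<gamma> f f +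
        (cnj c * moment_form \<gamma> f g + c * moment_form \<gamma> g f) + of_real ((cmod c)\<^sup>2) * moment_form \<gamma> g g"
      unfolding complex_norm_square by (simp add: moment_form_add_left moment_form_add_right
          moment_form_pconst_left moment_form_pconst_right distrib_left)
    ultimately show ?thesis
      using im[of "f + pconst c * g"] im[OF f] im[OF g] by (simp add: Im_complex_of_real)
  qed
  \<comment> \<open>\<open>c = 1\<close> compares imaginary parts, \<open>c = \<i>\<close> real
    parts.\<close>
  from this[of 1] this[of \<i>] show ?thesis by (simp add: complex_eq_iff)
qed

lemma coeff_vec_zmonom:
  assumes "a < num_monos TYPE('d::finite) l"
  shows "coeff_vec l (zmonom (mono_list l ! a :: 'd mono)) = unit_vec (num_monos TYPE('d) l) a"
  using assms mono_list_props[where 'd = 'd and l = l]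
  by (intro eq_vecI) (auto simp: coeff_vec_def zmonom_def lookup_single when_def nth_eq_iff_index_eq)

lemma index_poly_col:
  fixes \<gamma> :: "nat ^ 'd::finite \<Rightarrow> nat ^ 'd \<Rightarrow> complex"
  assumes p: "p \<in> poly_space l" and a: "a < num_monos TYPE('d) l"
  shows "vec_index (poly_col l \<gamma> p) a = moment_form \<gamma> p (zmonom (mono_list l ! a))"
proof -
  let ?N = "num_monos TYPE('d) l"
  have "mono_degree (mono_list l ! a :: 'd mono) \<le> l"
    using a nth_mem[of a "mono_list l :: 'd mono list"] by (simp add: mono_list_props)
  then have "(moment_matrix l \<gamma> *\<^sub>v coeff_vec l p) \<bullet>c unit_vec ?N a =
      moment_form \<gamma> p (zmonom (mono_list l ! a))"
    using moment_matrix_inner[OF p poly_space_zmonom, of "mono_list l ! a" \<gamma>] by (simp add: coeff_vec_zmonom[OF a] moment_form_def)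
  moreover have "conjugate (unit_vec ?N a :: complex Matrix.vec) = unit_vec ?N a"
    using a by (intro eq_vecI) (auto simp: unit_vec_def)
  moreover have "moment_matrix l \<gamma> *\<^sub>v coeff_vec l p \<in> carrier_vec ?N"
    using moment_matrix_carrier[of l \<gamma>] by (auto simp: coeff_vec_def)
  ultimately show ?thesis
    using a by (simp add: poly_col_eq_mult[OF p] scalar_prod_right_unit)
qed

lemma dim_poly_col:
  fixes \<gamma> :: "nat ^ 'd::finite \<Rightarrow> nat ^ 'd \<Rightarrow> complex"
  shows "p \<in> poly_space l \<Longrightarrow> dim_vec (poly_col l \<gamma> p) = num_monos TYPE('d) l"
  using moment_matrix_carrier[of l \<gamma>] by (simp add: poly_col_eq_mult)

lemma moment_form_zmonom_right_expand:
  "moment_form \<gamma> p g = (\<Sum>m\<in>Poly_Mapping.keys g. cnj (Poly_Mapping.lookup g m) * moment_form \<gamma> p (zmonom m))"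
  by (subst zpoly_eq_sum_zmonom[of g]) (simp only: moment_form_sum_right moment_form_pconst_right)

lemma null_polys_iff_monos:
  fixes \<gamma> :: "nat ^ 'd::finite \<Rightarrow> nat ^ 'd \<Rightarrow> complex"
  assumes p: "p \<in> poly_space l"
  shows "p \<in> null_polys l \<gamma> \<longleftrightarrow>
    (\<forall>a<num_monos TYPE('d) l. moment_form \<gamma> p (zmonom (mono_list l ! a)) = 0)"
proof
  assume "p \<in> null_polys l \<gamma>"
  then show "\<forall>a<num_monos TYPE('d) l. moment_form \<gamma> p (zmonom (mono_list l ! a)) = 0"
    using mono_list_props[where 'd = 'd and l = l] nth_mem[of _ "mono_list l :: 'd mono list"]
    by (auto intro!: null_polysD poly_space_zmonom)
next
  assume *: "\<forall>a<num_monos TYPE('d) l. moment_form \<gamma> p (zmonom (mono_list l ! a)) = 0"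
  have "moment_form \<gamma> p (zmonom m) = 0" if "mono_degree m \<le> l" for m
  proof -
    have "m \<in> set (mono_list l)" using that by (simp add: mono_list_props)
    then show ?thesis using * by (auto simp: in_set_conv_nth mono_list_props(3))
  qed
  then have "moment_form \<gamma> p g = 0" if "g \<in> poly_space l" for g
    using that by (subst moment_form_zmonom_right_expand) (simp add: poly_space_def)
  then show "p \<in> null_polys l \<gamma>" using p by (simp add: null_polys_def)
qed

text \<open>Entry \<open>a\<close> of the column combination is the form of \<open>p\<close> against
  monomial \<open>a\<close>, and the monomials span the test polynomials. This identifies the
  variety with the common zeros of the null polynomials.\<close>

lemma null_polys_iff_poly_col:
  fixes \<gamma> :: "nat ^ 'd::finite \<Rightarrow> nat ^ 'd \<Rightarrow> complex"
  assumes p: "p \<in> poly_space l"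
  shows "p \<in> null_polys l \<gamma> \<longleftrightarrow> poly_col l \<gamma> p = 0\<^sub>v (num_monos TYPE('d) l)"
  unfolding null_polys_iff_monos[OF p] Matrix.vec_eq_iff
  by (simp add: dim_poly_col[OF p] index_poly_col[OF p])

lemma moment_variety_eq: "moment_variety l \<gamma> = (\<Inter>p\<in>null_polys l \<gamma>. zero_set p)"
proof -
  have "{p \<in> poly_space l. poly_col l \<gamma> p = 0\<^sub>v (num_monos TYPE('a) l)} = null_polys l \<gamma>"
    using null_polys_iff_poly_col null_polys_in_space by blast
  then show ?thesis by (simp add: moment_variety_def)
qed

subsection \<open>Linear independence of columns\<close>

definition column_relation :: "'d::finite mono list \<Rightarrow> (nat \<Rightarrow> complex) \<Rightarrow> 'd zpoly" where
  "column_relation bs c = (\<Sum>i<length bs. pconst (c i) * zmonom (bs ! i))"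

text \<open>Independence of the columns as an indexed family: a repeated column counts as a
  dependence, which \<open>lin_indpt\<close> of the set of columns would not detect.\<close>

definition indep_monos ::
  "nat \<Rightarrow> (nat ^ 'd::finite \<Rightarrow> nat ^ 'd \<Rightarrow> complex) \<Rightarrow> 'd mono list \<Rightarrow> bool" where
  "indep_monos l \<gamma> bs \<longleftrightarrow>
     (\<forall>c. column_relation bs c \<in> null_polys l \<gamma> \<longrightarrow> (\<forall>i<length bs. c i = 0))"

lemma column_relation_mem:
  assumes "\<forall>m\<in>set bs. mono_degree m \<le> l"
  shows "column_relation bs c \<in> poly_space l"
  unfolding column_relation_def using assms
  by (intro poly_space_sum poly_space_pconst_mult poly_space_zmonom) auto

lemma moment_col_eq_poly_col:
  fixes \<gamma> :: "nat ^ 'd::finite \<Rightarrow> nat ^ 'd \<Rightarrow> complex"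
  assumes "mono_degree m \<le> l"
  shows "moment_col l \<gamma> m = poly_col l \<gamma> (zmonom m)"
proof -
  obtain b where b: "b < num_monos TYPE('d) l" "mono_list l ! b = m"
    using assms mono_list_props(2,3)[where 'd = 'd and l = l] in_set_conv_nth[of m "mono_list l"] by auto
  have "moment_matrix l \<gamma> *\<^sub>v unit_vec (num_monos TYPE('d) l) b = Matrix.col (moment_matrix l \<gamma>) b"
    using b(1) moment_matrix_carrier[of l \<gamma>]
    by (intro eq_vecI) (auto simp: scalar_prod_right_unit)
  then show ?thesis
    using moment_col_nth[OF b(1), of \<gamma>] coeff_vec_zmonom[OF b(1)] b(2)
      poly_col_eq_mult[OF poly_space_zmonom[OF assms], of \<gamma>] by simp
qed

lemma moment_col_carrier:
  fixes \<gamma> :: "nat ^ 'd::finite \<Rightarrow> nat ^ 'd \<Rightarrow> complex"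
  shows "moment_col l \<gamma> m \<in> carrier_vec (num_monos TYPE('d) l)"
  by (rule carrier_vecI) (simp add: moment_col_def moment_matrix_def)

lemma set_cols_moment_matrix:
  fixes \<gamma> :: "nat ^ 'd::finite \<Rightarrow> nat ^ 'd \<Rightarrow> complex"
  shows "set (cols (moment_matrix l \<gamma>)) = moment_col l \<gamma> ` {m. mono_degree m \<le> l}"
proof -
  let ?ms = "mono_list l :: 'd mono list"
  have "set (cols (moment_matrix l \<gamma>)) = (\<lambda>b. moment_col l \<gamma> (?ms ! b)) ` {0..<num_monos TYPE('d) l}"
    using moment_matrix_carrier[of l \<gamma>] by (auto simp: cols_def moment_col_nth)
  also have "\<dots> = moment_col l \<gamma> ` ((!) ?ms ` {0..<length ?ms})"
    by (simp add: image_image mono_list_props(3))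
  also have "(!) ?ms ` {0..<length ?ms} = set ?ms"
    by (simp add: nth_image)
  finally show ?thesis by (simp add: mono_list_props)
qed

lemma mat_of_moment_cols_mult_eq_0_iff:
  fixes \<gamma> :: "nat ^ 'd::finite \<Rightarrow> nat ^ 'd \<Rightarrow> complex"
  assumes bs: "\<forall>m\<in>set bs. mono_degree m \<le> l" and v: "v \<in> carrier_vec (length bs)"
  shows "mat_of_cols (num_monos TYPE('d) l) (map (moment_col l \<gamma>) bs) *\<^sub>v v = 0\<^sub>v (num_monos TYPE('d) l) \<longleftrightarrow>
    column_relation bs (vec_index v) \<in> null_polys l \<gamma>"
proof -
  let ?N = "num_monos TYPE('d) l"
  let ?A = "mat_of_cols ?N (map (moment_col l \<gamma>) bs)"
  have "vec_index (?A *\<^sub>v v) a = moment_form \<gamma> (column_relation bs (vec_index v)) (zmonom (mono_list l ! a))"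
    if a: "a < ?N" for a
  proof -
    have "vec_index (?A *\<^sub>v v) a = (\<Sum>i<length bs. vec_index v i * vec_index (moment_col l \<gamma> (bs ! i)) a)"
      using a v by (simp add: scalar_prod_def mat_of_cols_index atLeast0LessThan mult.commute)
    also have "\<dots> = (\<Sum>i<length bs. vec_index v i * moment_form \<gamma> (zmonom (bs ! i)) (zmonom (mono_list l ! a)))"
      using bs a by (intro sum.cong) (auto simp: moment_col_eq_poly_col index_poly_col poly_space_zmonom)
    finally show ?thesis
      by (simp add: column_relation_def moment_form_sum_left moment_form_pconst_left)
  qed
  then show ?thesis
    unfolding null_polys_iff_monos[OF column_relation_mem[OF bs]] Matrix.vec_eq_iff by auto
qed

lemma indep_monos_distinct:
  assumes bs: "\<forall>m\<in>set bs. mono_degree m \<le> l" and ind: "indep_monos l \<gamma> bs"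
  shows "distinct (map (moment_col l \<gamma>) bs)"
  unfolding distinct_conv_nth
proof (intro allI impI notI)
  fix i j assume ij: "i < length (map (moment_col l \<gamma>) bs)" "j < length (map (moment_col l \<gamma>) bs)" "i \<noteq> j"
    and eq: "map (moment_col l \<gamma>) bs ! i = map (moment_col l \<gamma>) bs ! j"
  \<comment> \<open>Equal columns at positions \<open>i\<close> and \<open>j\<close> give the
    relation with coefficients 1 and -1.\<close>
  define c :: "nat \<Rightarrow> complex" where "c k = (if k = i then 1 else if k = j then -1 else 0)" for k
  have "column_relation bs c = (\<Sum>k<length bs. (if k = i then zmonom (bs ! i) else 0) -
      (if k = j then zmonom (bs ! j) else 0))"
    unfolding column_relation_def c_def using ij(3)
    by (intro sum.cong) (auto simp: pconst_uminus)
  also have "\<dots> = zmonom (bs ! i) - zmonom (bs ! j)" using ij by (simp add: sum_subtractf)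
  finally have rel: "column_relation bs c = zmonom (bs ! i) - zmonom (bs ! j)" .
  have "column_relation bs c \<in> null_polys l \<gamma>"
    unfolding null_polys_iff_monos[OF column_relation_mem[OF bs]]
  proof (intro allI impI)
    fix a assume a: "a < num_monos TYPE('a) l"
    have "vec_index (poly_col l \<gamma> (zmonom (bs ! i))) a = vec_index (poly_col l \<gamma> (zmonom (bs ! j))) a"
      using eq ij bs by (simp add: moment_col_eq_poly_col)
    then show "moment_form \<gamma> (column_relation bs c) (zmonom (mono_list l ! a)) = 0"
      using ij bs a by (simp add: rel moment_form_diff_left index_poly_col poly_space_zmonom)
  qed
  then have "c i = 0" using ind ij by (simp add: indep_monos_def)
  then show False by (simp add: c_def)
qed

text \<open>Both sides say that the matrix of the listed columns has trivial kernel; distinctness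
  lets the set stand for the list.\<close>

lemma indep_monos_iff_lin_indpt:
  fixes \<gamma> :: "nat ^ 'd::finite \<Rightarrow> nat ^ 'd \<Rightarrow> complex"
  assumes bs: "\<forall>m\<in>set bs. mono_degree m \<le> l" and d: "distinct (map (moment_col l \<gamma>) bs)"
  shows "indep_monos l \<gamma> bs \<longleftrightarrow>
    module.lin_indpt class_ring (module_vec TYPE(complex) (num_monos TYPE('d) l))
      (set (map (moment_col l \<gamma>) bs))"
proof -
  let ?N = "num_monos TYPE('d) l"
  interpret vec_space "TYPE(complex)" ?N .
  let ?A = "mat_of_cols ?N (map (moment_col l \<gamma>) bs)"
  have A: "?A \<in> carrier_mat ?N (length bs)"
    using mat_of_cols_carrier(1)[of ?N "map (moment_col l \<gamma>) bs"] by simp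
  have cols: "cols ?A = map (moment_col l \<gamma>) bs"
    using moment_col_carrier by (intro cols_mat_of_cols) auto
  have "lin_dep (set (cols ?A)) \<longleftrightarrow>
      (\<exists>v. v \<in> carrier_vec (length bs) \<and> v \<noteq> 0\<^sub>v (length bs) \<and> ?A *\<^sub>v v = 0\<^sub>v ?N)"
    using lin_depI[OF A] lin_depE[OF A] d cols by metis
  also have "\<dots> \<longleftrightarrow> \<not> indep_monos l \<gamma> bs"
  proof
    assume "\<exists>v. v \<in> carrier_vec (length bs) \<and> v \<noteq> 0\<^sub>v (length bs) \<and> ?A *\<^sub>v v = 0\<^sub>v ?N"
    then obtain v where v: "v \<in> carrier_vec (length bs)" "v \<noteq> 0\<^sub>v (length bs)"
      "column_relation bs (vec_index v) \<in> null_polys l \<gamma>"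
      using mat_of_moment_cols_mult_eq_0_iff[OF bs] by blast
    then have "\<exists>i<length bs. vec_index v i \<noteq> 0" by (auto simp: Matrix.vec_eq_iff)
    with v(3) show "\<not> indep_monos l \<gamma> bs" by (auto simp: indep_monos_def)
  next
    assume "\<not> indep_monos l \<gamma> bs"
    then obtain c i where c: "column_relation bs c \<in> null_polys l \<gamma>" "i < length bs" "c i \<noteq> 0"
      by (auto simp: indep_monos_def)
    let ?v = "Matrix.vec (length bs) c"
    have "column_relation bs (vec_index ?v) = column_relation bs c"
      by (simp add: column_relation_def)
    then have "?A *\<^sub>v ?v = 0\<^sub>v ?N"
      using mat_of_moment_cols_mult_eq_0_iff[OF bs, of ?v \<gamma>] c(1) by simp
    moreover have "?v \<noteq> 0\<^sub>v (length bs)" using c(2,3) by (auto simp: Matrix.vec_eq_iff)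
    ultimately show "\<exists>v. v \<in> carrier_vec (length bs) \<and> v \<noteq> 0\<^sub>v (length bs) \<and> ?A *\<^sub>v v = 0\<^sub>v ?N"
      by (intro exI[of _ ?v]) simp
  qed
  finally show ?thesis unfolding cols by blast
qed

lemma indep_monos_length_le_rank:
  fixes \<gamma> :: "nat ^ 'd::finite \<Rightarrow> nat ^ 'd \<Rightarrow> complex"
  assumes bs: "\<forall>m\<in>set bs. mono_degree m \<le> l" and ind: "indep_monos l \<gamma> bs"
  shows "length bs \<le> moment_rank l \<gamma>"
proof -
  let ?N = "num_monos TYPE('d) l"
  interpret vec_space "TYPE(complex)" ?N .
  have d: "distinct (map (moment_col l \<gamma>) bs)" using indep_monos_distinct[OF bs ind] .
  have "card (set (map (moment_col l \<gamma>) bs)) \<le> rank (moment_matrix l \<gamma>)"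
  proof (rule rank_ge_card_indpt[OF moment_matrix_carrier])
    show "set (map (moment_col l \<gamma>) bs) \<subseteq> set (cols (moment_matrix l \<gamma>))"
      using bs by (auto simp: set_cols_moment_matrix)
    show "lin_indpt (set (map (moment_col l \<gamma>) bs))"
      using indep_monos_iff_lin_indpt[OF bs d] ind by blast
  qed
  then show ?thesis using distinct_card[OF d] by (simp add: moment_rank_def)
qed

lemma max_indpt_columnsD:
  fixes \<gamma> :: "nat ^ 'd::finite \<Rightarrow> nat ^ 'd \<Rightarrow> complex"
  assumes "max_indpt_columns l \<gamma> bs"
  shows "\<forall>m\<in>set bs. mono_degree m \<le> l" "length bs = moment_rank l \<gamma>" "indep_monos l \<gamma> bs"
proof -
  let ?N = "num_monos TYPE('d) l"
  interpret vec_space "TYPE(complex)" ?N .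
  show bs: "\<forall>m\<in>set bs. mono_degree m \<le> l" using assms by (simp add: max_indpt_columns_def)
  have d: "distinct (map (moment_col l \<gamma>) bs)" using assms by (simp add: max_indpt_columns_def)
  have max: "maximal (set (map (moment_col l \<gamma>) bs)) (\<lambda>T. T \<subseteq> set (cols (moment_matrix l \<gamma>)) \<and> lin_indpt T)"
    using assms unfolding max_indpt_columns_def by blast
  show "length bs = moment_rank l \<gamma>"
    using rank_card_indpt[OF moment_matrix_carrier max] distinct_card[OF d] by (simp add: moment_rank_def)
  show "indep_monos l \<gamma> bs"
    using max indep_monos_iff_lin_indpt[OF bs d] by (simp add: maximal_def)
qed

lemma max_indpt_columns_exists:
  fixes \<gamma> :: "nat ^ 'd::finite \<Rightarrow> nat ^ 'd \<Rightarrow> complex"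
  obtains bs where "max_indpt_columns l \<gamma> bs"
proof -
  let ?N = "num_monos TYPE('d) l"
  interpret vec_space "TYPE(complex)" ?N .
  let ?P = "\<lambda>T. T \<subseteq> set (cols (moment_matrix l \<gamma>)) \<and> lin_indpt T"
  have "?P {}" by (auto simp: lin_dep_def)
  from maximal_exists_superset[of "set (cols (moment_matrix l \<gamma>))" ?P "{}"] this
  obtain S where S: "finite S" "maximal S ?P" by auto
  then have sub: "S \<subseteq> moment_col l \<gamma> ` {m. mono_degree m \<le> l}"
    by (simp add: maximal_def set_cols_moment_matrix)
  \<comment> \<open>One label is chosen for each column, because different monomials may label equal
    columns.\<close>
  then obtain B where B: "B \<subseteq> {m. mono_degree m \<le> l}" "inj_on (moment_col l \<gamma>) B" "S = moment_col l \<gamma> ` B"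
    by (rule subset_image_inj[THEN iffD1, THEN exE]) blast
  have "finite B" using B(1) finite_monos by (rule finite_subset)
  then obtain bs where bs: "set bs = B" "distinct bs" using finite_distinct_list by blast
  have "max_indpt_columns l \<gamma> bs"
    unfolding max_indpt_columns_def using S(2) B bs by (auto simp: distinct_map)
  then show thesis by (rule that)
qed

section \<open>Flat extensions\<close>

lemma null_polys_restrict:
  "p \<in> null_polys l' \<gamma> \<Longrightarrow> p \<in> poly_space l \<Longrightarrow> l \<le> l' \<Longrightarrow> p \<in> null_polys l \<gamma>"
  by (auto simp: null_polys_def intro: poly_space_mono)

text \<open>Appending \<open>m\<close> to \<open>bs\<close> gives more columns than the rank of the
  larger matrix, so they are dependent. The coefficient of \<open>m\<close> is nonzero: a relation
  among \<open>bs\<close> alone would restrict to the smaller matrix, where \<open>bs\<close> is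
  independent.\<close>

lemma flat_extension_span_mono:
  assumes rank: "moment_rank (Suc n) \<gamma> = moment_rank n \<gamma>" and bs: "max_indpt_columns n \<gamma> bs"
    and m: "mono_degree m \<le> Suc n"
  shows "\<exists>a. zmonom m - column_relation bs a \<in> null_polys (Suc n) \<gamma>"
proof -
  note B = max_indpt_columnsD[OF bs]
  let ?r = "length bs"
  have B': "\<forall>m\<in>set (bs @ [m]). mono_degree m \<le> Suc n" using B(1) m by auto
  have "\<not> indep_monos (Suc n) \<gamma> (bs @ [m])"
    using indep_monos_length_le_rank[OF B'] rank B(2) by fastforce
  then obtain c i where c: "column_relation (bs @ [m]) c \<in> null_polys (Suc n) \<gamma>" "i < Suc ?r" "c i \<noteq> 0"
    by (auto simp: indep_monos_def)
  have split: "column_relation (bs @ [m]) c = column_relation bs c + pconst (c ?r) * zmonom m"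
    by (simp add: column_relation_def nth_append)
  have "c ?r \<noteq> 0"
  proof
    assume z: "c ?r = 0"
    then have "column_relation bs c \<in> null_polys (Suc n) \<gamma>" using c(1) split by simp
    then have "column_relation bs c \<in> null_polys n \<gamma>"
      using column_relation_mem[OF B(1)] by (rule null_polys_restrict) simp
    then have "\<forall>i<?r. c i = 0" using B(3) by (simp add: indep_monos_def)
    then show False using c(2,3) z by (auto simp: less_Suc_eq)
  qed
  then have "zmonom m - column_relation bs (\<lambda>i. - (c i / c ?r)) =
      pconst (1 / c ?r) * column_relation (bs @ [m]) c"
    unfolding split
    by (simp add: column_relation_def distrib_left sum_distrib_left pconst_uminus sum_negf
        flip: pconst_mult mult.assoc)
  then show ?thesis using null_polys_pconst_mult[OF c(1)] by metis
qed

lemma flat_extension_span: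
  assumes rank: "moment_rank (Suc n) \<gamma> = moment_rank n \<gamma>" and bs: "max_indpt_columns n \<gamma> bs"
    and f: "f \<in> poly_space (Suc n)"
  shows "\<exists>a. f - column_relation bs a \<in> null_polys (Suc n) \<gamma>"
proof -
  let ?K = "Poly_Mapping.keys f"
  have "\<forall>m\<in>?K. \<exists>a. zmonom m - column_relation bs a \<in> null_polys (Suc n) \<gamma>"
    using f flat_extension_span_mono[OF rank bs] unfolding poly_space_def by blast
  from bchoice[OF this] obtain a
    where a: "\<And>m. m \<in> ?K \<Longrightarrow> zmonom m - column_relation bs (a m) \<in> null_polys (Suc n) \<gamma>" by blast
  let ?c = "\<lambda>m. Poly_Mapping.lookup f m"
  have "column_relation bs (\<lambda>i. \<Sum>m\<in>?K. ?c m * a m i) = (\<Sum>m\<in>?K. pconst (?c m) * column_relation bs (a m))"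
    unfolding column_relation_def pconst_sum sum_distrib_right sum_distrib_left pconst_mult
    by (subst sum.swap) (simp add: mult.assoc)
  then have "f - column_relation bs (\<lambda>i. \<Sum>m\<in>?K. ?c m * a m i) =
      (\<Sum>m\<in>?K. pconst (?c m) * (zmonom m - column_relation bs (a m)))"
    using zpoly_eq_sum_zmonom[of f] by (simp add: right_diff_distrib sum_subtractf)
  also have "\<dots> \<in> null_polys (Suc n) \<gamma>"
    using a by (intro null_polys_sum null_polys_pconst_mult)
  finally show ?thesis by blast
qed

text \<open>Independence of the basis comes from the smaller matrix, spanning from the equality of
  ranks, and the properties of the form from positivity of the larger matrix.\<close>

lemma flat_extension_flat_form:
  fixes \<gamma> :: "nat ^ 'd::finite \<Rightarrow> nat ^ 'd \<Rightarrow> complex"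
  assumes psd: "psd_mat (moment_matrix (Suc n) \<gamma>)"
    and rank: "moment_rank (Suc n) \<gamma> = moment_rank n \<gamma>" and bs: "max_indpt_columns n \<gamma> bs"
  shows "flat_form n (moment_rank n \<gamma>) \<gamma> (\<lambda>i. zmonom (bs ! i))"
proof (rule flat_form.intro)
  fix f g :: "'d zpoly" assume "f \<in> poly_space (Suc n)" "g \<in> poly_space (Suc n)"
  then show "moment_form \<gamma> g f = cnj (moment_form \<gamma> f g)"
    by (rule psd_moment_form_hermitian[OF psd])
next
  fix f :: "'d zpoly" assume "f \<in> poly_space (Suc n)"
  then show "0 \<le> Re (moment_form \<gamma> f f)"
    by (rule psd_moment_form(2)[OF psd])
next
  note B = max_indpt_columnsD[OF bs]
  fix i assume "i < moment_rank n \<gamma>"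
  then show "zmonom (bs ! i) \<in> poly_space n"
    using B(1,2) by (simp add: poly_space_zmonom)
next
  note B = max_indpt_columnsD[OF bs]
  fix a i assume a: "(\<Sum>i<moment_rank n \<gamma>. pconst (a i) * zmonom (bs ! i)) \<in> null_polys (Suc n) \<gamma>"
    and i: "i < moment_rank n \<gamma>"
  from a have "column_relation bs a \<in> null_polys (Suc n) \<gamma>"
    unfolding column_relation_def B(2) .
  then have "column_relation bs a \<in> null_polys n \<gamma>"
    using column_relation_mem[OF B(1)] by (rule null_polys_restrict) simp
  then show "a i = 0" using B(2,3) i by (simp add: indep_monos_def)
next
  fix f :: "'d zpoly" assume "f \<in> poly_space (Suc n)"
  from flat_extension_span[OF rank bs this]
  show "\<exists>a. f - (\<Sum>i<moment_rank n \<gamma>. pconst (a i) * zmonom (bs ! i)) \<in> null_polys (Suc n) \<gamma>"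
    unfolding column_relation_def max_indpt_columnsD(2)[OF bs] .
qed

lemma moment_matrix_cong:
  fixes \<gamma> \<gamma>' :: "nat ^ 'd::finite \<Rightarrow> nat ^ 'd \<Rightarrow> complex"
  assumes "\<And>i j. mono_degree (i, j) \<le> 2 * l \<Longrightarrow> \<gamma>' i j = \<gamma> i j"
  shows "moment_matrix l \<gamma>' = moment_matrix l \<gamma>"
proof -
  have "riesz \<gamma>' (zmonom (mono_list l ! b) * conj_poly (zmonom (mono_list l ! a))) =
      riesz \<gamma> (zmonom (mono_list l ! b) * conj_poly (zmonom (mono_list l ! a)))"
    if "a < num_monos TYPE('d) l" "b < num_monos TYPE('d) l" for a b
  proof (rule riesz_cong[of _ "2 * l"])
    have "mono_degree (mono_list l ! c :: 'd mono) \<le> l" if "c < num_monos TYPE('d) l" for c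
      using that nth_mem[of c "mono_list l :: 'd mono list"] by (simp add: mono_list_props)
    then show "zmonom (mono_list l ! b :: 'd mono) * conj_poly (zmonom (mono_list l ! a)) \<in> poly_space (2 * l)"
      using that by (simp add: mult_2 conj_poly_zmonom poly_space_mult poly_space_zmonom)
  qed (rule assms)
  then show ?thesis unfolding moment_matrix_def by (intro cong_mat) auto
qed

lemma det_nonzero_inverse:
  fixes A :: "'a::field mat"
  assumes A: "A \<in> carrier_mat n n" and det: "Determinant.det A \<noteq> 0"
  shows "invertible_mat A" "the (mat_inverse A) * A = 1\<^sub>m n" "the (mat_inverse A) \<in> carrier_mat n n"
proof -
  have "A \<in> Units (ring_mat TYPE('a) n ())" using det_non_zero_imp_unit[OF A det] .
  then obtain B where B: "mat_inverse A = Some B" using mat_inverse(1)[OF A] by fastforce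
  from mat_inverse(2)[OF A B]
  show "invertible_mat A" "the (mat_inverse A) * A = 1\<^sub>m n" "the (mat_inverse A) \<in> carrier_mat n n"
    using A B by (auto simp: invertible_mat_def inverts_mat_def)
qed

section \<open>Basis monomials evaluated at the nodes\<close>

context quadrature
begin

text \<open>A kernel vector of the transpose is a combination of basis monomials vanishing at all
  nodes. Such a polynomial is null, so its coefficients are zero by independence of the
  columns.\<close>

lemma det_W_mat:
  assumes bs: "\<forall>m\<in>set bs. mono_degree m \<le> n" "indep_monos n \<gamma> bs" "length bs = r"
    and ws: "distinct ws" "set ws = nodes"
  shows "W_mat bs ws \<in> carrier_mat r r" "Determinant.det (W_mat bs ws) \<noteq> 0"
proof -
  have len: "length ws = r" using distinct_card[OF ws(1)] ws(2) card_nodes(2) by simp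
  show W: "W_mat bs ws \<in> carrier_mat r r" using bs(3) len by (simp add: W_mat_def)
  show "Determinant.det (W_mat bs ws) \<noteq> 0"
  proof
    assume "Determinant.det (W_mat bs ws) = 0"
    then have "Determinant.det (transpose_mat (W_mat bs ws)) = 0" using Determinant.det_transpose[OF W] by simp
    then obtain v where v: "v \<in> carrier_vec r" "v \<noteq> 0\<^sub>v r" "transpose_mat (W_mat bs ws) *\<^sub>v v = 0\<^sub>v r"
      using det_0_iff_vec_prod_zero[of "transpose_mat (W_mat bs ws)" r] W by auto
    let ?p = "column_relation bs (vec_index v)"
    have zero: "poly_eval ?p (ws ! k) = 0" if k: "k < r" for k
    proof -
      have "vec_index (transpose_mat (W_mat bs ws) *\<^sub>v v) k = poly_eval ?p (ws ! k)"
        unfolding column_relation_def poly_eval_sum poly_eval_pconst_mult poly_eval_zmonom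
        using k v(1) bs(3) len
        by (simp add: W_mat_def scalar_prod_def atLeast0LessThan mult.commute)
      then show ?thesis using v(3) k by simp
    qed
    have p: "?p \<in> poly_space n" by (rule column_relation_mem[OF bs(1)])
    have pS: "?p \<in> poly_space (Suc n)" by (rule poly_space_mono[OF p]) simp
    have "poly_eval ?p z = 0" if "z \<in> nodes" for z
    proof -
      have "z \<in> set ws" using that ws(2) by simp
      then obtain k where "k < r" "z = ws ! k" unfolding in_set_conv_nth len by blast
      then show ?thesis using zero by simp
    qed
    then have "?p \<in> null_polys (Suc n) \<gamma>"
      unfolding null_polys_iff[OF pS] by (simp add: nodes_def)
    then have "?p \<in> null_polys n \<gamma>" by (rule null_polys_restrict[OF _ p]) simp
    then have "\<forall>i<r. vec_index v i = 0" using bs(2,3) by (simp add: indep_monos_def)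
    then show False using v(1,2) by (auto simp: Matrix.vec_eq_iff)
  qed
qed

text \<open>Weights attached to points instead of indices, since \<open>ws\<close> may list the
  nodes in an order different from that of \<open>\<omega>\<close>.\<close>

definition node_weight :: "complex ^ 'd \<Rightarrow> real" where
  "node_weight z = \<rho> (the_inv_into {..<r} \<omega> z)"

lemma node_weight_pos: "z \<in> nodes \<Longrightarrow> 0 < node_weight z"
  using inj_nodes by (auto simp: node_weight_def nodes_def the_inv_into_f_f weight_pos)

lemma sum_node_weight:
  fixes F :: "real \<Rightarrow> complex ^ 'd \<Rightarrow> 'b::comm_monoid_add"
  assumes ws: "distinct ws" "set ws = nodes"
  shows "(\<Sum>k<length ws. F (node_weight (ws ! k)) (ws ! k)) = (\<Sum>i<r. F (\<rho> i) (\<omega> i))"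
proof -
  have "(\<Sum>k<length ws. F (node_weight (ws ! k)) (ws ! k)) = (\<Sum>z\<in>nodes. F (node_weight z) z)"
    by (rule sum.reindex_bij_betw[OF bij_betw_nth[OF ws(1) refl ws(2)[symmetric]]])
  also have "\<dots> = (\<Sum>i<r. F (\<rho> i) (\<omega> i))"
    unfolding nodes_def using inj_nodes
    by (subst sum.reindex) (auto simp: node_weight_def the_inv_into_f_f intro!: sum.cong)
  finally show ?thesis .
qed

text \<open>Row \<open>m\<close> of the system is the quadrature formula for the moment of
  \<open>bs ! m\<close>, so the weights solve it, and multiplying by the inverse recovers
  them.\<close>

lemma W_mat_solution:
  assumes bs: "\<forall>m\<in>set bs. mono_degree m \<le> n" "indep_monos n \<gamma> bs" "length bs = r"
    and ws: "distinct ws" "set ws = nodes"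
  shows "the (mat_inverse (W_mat bs ws)) *\<^sub>v Matrix.vec (length bs) (\<lambda>k. \<gamma> (fst (bs ! k)) (snd (bs ! k))) =
    Matrix.vec r (\<lambda>k. of_real (node_weight (ws ! k)))" (is "?B *\<^sub>v ?g = ?x")
proof -
  have len: "length ws = r" using distinct_card[OF ws(1)] ws(2) card_nodes(2) by simp
  note W = det_W_mat[OF assms]
  note B = det_nonzero_inverse[OF W]
  have "?g = W_mat bs ws *\<^sub>v ?x"
  proof (rule eq_vecI)
    fix m assume "m < dim_vec (W_mat bs ws *\<^sub>v ?x)"
    then have m: "m < r" using W(1) by simp
    have "mono_degree (fst (bs ! m), snd (bs ! m)) \<le> 2 * n + 2" using bs(1,3) m nth_mem[of m bs] by fastforce
    then have "\<gamma> (fst (bs ! m)) (snd (bs ! m)) = (\<Sum>i<r. of_real (\<rho> i) * mono_eval (bs ! m) (\<omega> i))"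
      using moment_eq by fastforce
    also have "\<dots> = (\<Sum>k<r. of_real (node_weight (ws ! k)) * mono_eval (bs ! m) (ws ! k))"
      using sum_node_weight[OF ws, of "\<lambda>x z. of_real x * mono_eval (bs ! m) z"] by (simp add: len)
    finally show "vec_index ?g m = vec_index (W_mat bs ws *\<^sub>v ?x) m"
      using m bs(3) len by (simp add: W_mat_def scalar_prod_def atLeast0LessThan mult.commute)
  qed (use W(1) bs(3) in simp)
  then have "?B *\<^sub>v ?g = ?B *\<^sub>v (W_mat bs ws *\<^sub>v ?x)" by simp
  also have "\<dots> = (?B * W_mat bs ws) *\<^sub>v ?x"
    using B(3) W(1) by (simp add: assoc_mult_mat_vec[of _ r r _ r])
  also have "\<dots> = ?x" using B(2) by simp
  finally show ?thesis .
qed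

lemma quadrature_measure_eq_atomic:
  assumes ws: "distinct ws" "set ws = nodes" and x: "\<And>k. k < r \<Longrightarrow> x k = node_weight (ws ! k)"
  shows "quadrature_measure = atomic_measure ws x"
proof (rule measure_eqI)
  show sets: "sets quadrature_measure = sets (atomic_measure ws x)"
    using sets.sigma_sets_eq[of "borel :: (complex ^ 'd) measure"]
    by (simp add: sets_quadrature_measure atomic_measure_def)
  fix A assume "A \<in> sets quadrature_measure"
  then have A: "A \<in> sets borel" by (simp add: sets_quadrature_measure)
  have "length ws = r" using distinct_card[OF ws(1)] ws(2) card_nodes(2) by simp
  then show "emeasure quadrature_measure A = emeasure (atomic_measure ws x) A"
    using sum_node_weight[OF ws, of "\<lambda>x z. ennreal x * indicator A z"] x
    by (simp add: emeasure_quadrature_measure[OF A] emeasure_atomic_measure[OF A])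
qed

end

theorem theorem2p3:
  fixes n :: nat
    and \<gamma> \<gamma>' :: "nat ^ 'd::finite \<Rightarrow> nat ^ 'd \<Rightarrow> complex"
  assumes "psd_mat (moment_matrix n \<gamma>)"
    and "\<And>i j. mono_degree (i, j) \<le> 2 * n \<Longrightarrow> \<gamma>' i j = \<gamma> i j"
    and "psd_mat (moment_matrix (n + 1) \<gamma>')"
    and "moment_rank (n + 1) \<gamma>' = moment_rank n \<gamma>"
  shows "finite (moment_variety (n + 1) \<gamma>') \<and>
    card (moment_variety (n + 1) \<gamma>') = moment_rank n \<gamma> \<and>
    (\<exists>\<nu>. representing_measure (2 * n + 2) \<gamma>' \<nu> \<and>
         (\<forall>\<nu>'. representing_measure (2 * n + 2) \<gamma>' \<nu>' \<longrightarrow> \<nu>' = \<nu>) \<and>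
         measure_support \<nu> = moment_variety (n + 1) \<gamma>' \<and>
         (\<forall>bs ws. max_indpt_columns n \<gamma> bs \<and> distinct ws \<and>
            set ws = moment_variety (n + 1) \<gamma>' \<longrightarrow>
            W_mat bs ws \<in> carrier_mat (moment_rank n \<gamma>) (moment_rank n \<gamma>) \<and>
            invertible_mat (W_mat bs ws) \<and>
            (let \<rho> = the (mat_inverse (W_mat bs ws)) *\<^sub>v
                       Matrix.vec (length bs) (\<lambda>k. \<gamma> (fst (bs ! k)) (snd (bs ! k)))
             in (\<forall>k<moment_rank n \<gamma>. vec_index \<rho> k \<in> \<real> \<and> 0 < Re (vec_index \<rho> k)) \<and>
                \<nu> = atomic_measure ws (\<lambda>k. Re (vec_index \<rho> k)))))"
proof -
  \<comment> \<open>The entries are moments of degree at most \<open>2 * n\<close>, where the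
    sequences agree; all statements about the smaller matrix can be read for
    \<open>\<gamma>'\<close>.\<close>
  have M: "moment_matrix n \<gamma> = moment_matrix n \<gamma>'"
    using moment_matrix_cong[of n \<gamma>' \<gamma>] assms(2) by simp
  then have rank_eq: "moment_rank n \<gamma> = moment_rank n \<gamma>'" by (simp add: moment_rank_def)
  have max_eq: "max_indpt_columns n \<gamma> = max_indpt_columns n \<gamma>'"
    using M by (simp add: max_indpt_columns_def[abs_def] moment_col_def[abs_def])
  let ?r = "moment_rank n \<gamma>'"
  have psd: "psd_mat (moment_matrix (Suc n) \<gamma>')" and rank: "moment_rank (Suc n) \<gamma>' = ?r"
    using assms(3,4) rank_eq by simp_all
  \<comment> \<open>One arbitrary basis of columns produces the nodes and weights; the claim for
    every other \<open>bs\<close> is then proved about these same nodes.\<close>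
  obtain bs0 where bs0: "max_indpt_columns n \<gamma>' bs0" by (rule max_indpt_columns_exists)
  interpret flat_form n ?r \<gamma>' "\<lambda>i. zmonom (bs0 ! i)"
    by (rule flat_extension_flat_form[OF psd rank bs0])
  obtain \<omega> h \<rho> where "quadrature n ?r \<gamma>' \<omega> h \<rho>"
    by (rule obtain_quadrature)
  then interpret quadrature n ?r \<gamma>' \<omega> h \<rho> .
  have variety: "moment_variety (Suc n) \<gamma>' = nodes"
    by (simp add: moment_variety_eq zero_sets_null_polys)
  have atoms: "W_mat bs ws \<in> carrier_mat ?r ?r \<and> invertible_mat (W_mat bs ws) \<and>
      (let \<rho> = the (mat_inverse (W_mat bs ws)) *\<^sub>v
                 Matrix.vec (length bs) (\<lambda>k. \<gamma> (fst (bs ! k)) (snd (bs ! k)))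
       in (\<forall>k<?r. vec_index \<rho> k \<in> \<real> \<and> 0 < Re (vec_index \<rho> k)) \<and>
          quadrature_measure = atomic_measure ws (\<lambda>k. Re (vec_index \<rho> k)))"
    if bs: "max_indpt_columns n \<gamma>' bs" and ws: "distinct ws" "set ws = nodes" for bs ws
  proof -
    note B = max_indpt_columnsD[OF bs]
    note W = det_W_mat[OF B(1,3,2) ws]
    have g: "\<gamma> (fst (bs ! k)) (snd (bs ! k)) = \<gamma>' (fst (bs ! k)) (snd (bs ! k))" if "k < length bs" for k
      using assms(2)[of "fst (bs ! k)" "snd (bs ! k)"] B(1) nth_mem[OF that] by force
    have sol: "the (mat_inverse (W_mat bs ws)) *\<^sub>v
        Matrix.vec (length bs) (\<lambda>k. \<gamma> (fst (bs ! k)) (snd (bs ! k))) =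
        Matrix.vec ?r (\<lambda>k. of_real (node_weight (ws ! k)))"
    proof -
      have "Matrix.vec (length bs) (\<lambda>k. \<gamma> (fst (bs ! k)) (snd (bs ! k))) =
          Matrix.vec (length bs) (\<lambda>k. \<gamma>' (fst (bs ! k)) (snd (bs ! k)))"
        using g by (intro eq_vecI) simp_all
      then show ?thesis using W_mat_solution[OF B(1,3,2) ws] by simp
    qed
    have len: "length ws = ?r" using distinct_card[OF ws(1)] ws(2) card_nodes(2) by simp
    have "node_weight (ws ! k) > 0" if "k < ?r" for k
      using node_weight_pos nth_mem[of k ws] ws(2) len that by simp
    moreover have "quadrature_measure = atomic_measure ws
        (\<lambda>k. Re (vec_index (Matrix.vec ?r (\<lambda>k. complex_of_real (node_weight (ws ! k)))) k))"
      by (rule quadrature_measure_eq_atomic[OF ws]) simp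
    ultimately show ?thesis
      using W(1) det_nonzero_inverse(1)[OF W] by (simp add: Let_def sol)
  qed
  show ?thesis
    unfolding rank_eq max_eq Suc_eq_plus1[symmetric] variety
  proof (intro conjI exI[of _ quadrature_measure] allI impI)
    fix \<nu>' assume "representing_measure (2 * n + 2) \<gamma>' \<nu>'"
    then show "\<nu>' = quadrature_measure" by (rule representing_measure_unique)
  qed (use card_nodes representing_quadrature_measure support_quadrature_measure atoms in blast)+
qed

end
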